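(* Let $m\ge2$. (a) Let $f:\mathbb{T}^m\to\mathbb{T}^m$ be a non-invertible hyperbolic toral endomorphism (given by an integer matrix without zero eigenvalues), let $\phi:\mathbb{T}^m\to\mathbb{R}$ be an arbitrary Hölder continuous potential and let $\mu_\phi$ be its equilibrium measure with respect to $f$. Then the entropy production of $\mu_\phi$ is non-positive: $e_f(\mu_\phi)\le0$. Moreover the entropy production of the Haar (Lebesgue) measure on $\mathbb{T}^m$ with respect to $f$ equals $0$. (b) The same conclusions hold for any transitive, non-invertible $\mathcal{C}^2$ Anosov endomorphism $f:\mathbb{T}^m\to\mathbb{T}^m$ without critical points for which $\det Df$ is constant on $\mathbb{T}^m$: for every Hölder continuous potential $\phi$ on $\mathbb{T}^m$ one has $e_f(\mu_\phi)\le0$, and the entropy production of the Lebesgue measure with respect to $f$ equals $0$.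
   Context: Hyperbolic toral endomorphism: the map of $\mathbb{T}^m=\mathbb{R}^m/\mathbb{Z}^m$ induced by an integer $m\times m$ matrix $A$ having no eigenvalue of absolute value $1$; it is assumed to have stable directions (some eigenvalue of absolute value $<1$). Anosov endomorphism: a map $f$ hyperbolic on the whole manifold in the sense of endomorphisms, i.e. over the inverse limit $\{\hat x=(x,x_{-1},x_{-2},\ldots): f(x_{-i})=x_{-i+1},\ i\ge1\}$ there is a continuous $Df$-invariant splitting $T_x\mathbb{T}^m=E^s_x\oplus E^u_{\hat x}$ ($E^s_x$ depending only on $x$), uniformly contracted under iteration on $E^s$ and uniformly expanded on $E^u$; stable directions are assumed to be present. Here $\det Df$ is taken with respect to the standard flat Riemannian metric of $\mathbb{T}^m$. Equilibrium measure $\mu_\phi$ of $\phi$: the (unique) $f$-invariant Borel probability maximizing $h_\mu(f)+\int\phi\,d\mu$. Folding entropy of an $f$-invariant probability $\mu$: $F_f(\mu):=H_\mu(\epsilon\,|\,f^{-1}\epsilon)$, where $\epsilon$ is the partition into single points; i.e. $F_f(\mu)=\int H(\mu_x)\,d\mu(x)$, with $\mu_x$ the conditional measures of $\mu$ on the fibers $f^{-1}(x)$ and $H(\mu_x)=-\sum_{y\in f^{-1}(x)}\mu_x(y)\log\mu_x(y)$. Entropy production: $e_f(\mu):=F_f(\mu)-\int\log|\det Df(x)|\,d\mu(x)$. *)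

theory Defs
  imports "HOL-Probability.Probability"
begin

section \<open>The flat torus\<close>

definition int_lattice :: "(real ^ 'n::finite) set" where
  "int_lattice = {v. \<forall>i. v $ i \<in> \<int>}"

lemma int_lattice_0: "0 \<in> int_lattice"
  and int_lattice_minus: "v \<in> int_lattice \<Longrightarrow> - v \<in> int_lattice"
  and int_lattice_add: "v \<in> int_lattice \<Longrightarrow> w \<in> int_lattice \<Longrightarrow> v + w \<in> int_lattice"
  and int_lattice_diff: "v \<in> int_lattice \<Longrightarrow> w \<in> int_lattice \<Longrightarrow> v - w \<in> int_lattice"
  by (auto simp: int_lattice_def)

lemma closed_int_lattice: "closed (int_lattice :: (real ^ 'n::finite) set)"
proof -
  have "int_lattice = (\<Inter>i. (\<lambda>v :: real ^ 'n. v $ i) -` \<int>)"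
    by (auto simp: int_lattice_def)
  moreover have "closed ((\<lambda>v :: real ^ 'n. v $ i) -` \<int>)" for i
    by (intro continuous_closed_vimage closed_Ints continuous_intros)
  ultimately show ?thesis
    by (metis (no_types, lifting) closed_INT)
qed

definition lattice_eq :: "real ^ 'n::finite \<Rightarrow> real ^ 'n \<Rightarrow> bool" where
  "lattice_eq x y \<longleftrightarrow> x - y \<in> int_lattice"

lemma equivp_lattice_eq: "equivp (lattice_eq :: real ^ 'n::finite \<Rightarrow> _)"
proof (rule equivpI)
  show "reflp (lattice_eq :: real ^ 'n \<Rightarrow> _)"
    by (auto simp: reflp_def lattice_eq_def int_lattice_0)
  show "symp (lattice_eq :: real ^ 'n \<Rightarrow> _)"
    unfolding symp_def lattice_eq_def by (metis int_lattice_minus minus_diff_eq)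
  show "transp (lattice_eq :: real ^ 'n \<Rightarrow> _)"
  proof (rule transpI)
    fix x y z :: "real ^ 'n"
    assume "lattice_eq x y" "lattice_eq y z"
    then have "(x - y) + (y - z) \<in> int_lattice"
      unfolding lattice_eq_def by (rule int_lattice_add)
    then show "lattice_eq x z"
      by (simp add: lattice_eq_def)
  qed
qed

quotient_type (overloaded) 'n torus = "real ^ 'n::finite" / lattice_eq
  morphisms torus_rep torus_proj
  by (rule equivp_lattice_eq)

lemma torus_proj_eq_iff: "torus_proj x = torus_proj y \<longleftrightarrow> x - y \<in> int_lattice"
  using torus.abs_eq_iff lattice_eq_def by blast

lemma infdist_lattice_cong:
  assumes "x - y \<in> int_lattice"
  shows "infdist x int_lattice = infdist y int_lattice"
proof -
  have *: "infdist a int_lattice \<le> infdist b int_lattice"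
    if "a - b \<in> int_lattice" for a b :: "real ^ 'n"
  proof -
    have ne: "int_lattice \<noteq> ({} :: (real ^ 'n) set)"
      using int_lattice_0 by blast
    have "infdist a int_lattice \<le> dist b k" if "k \<in> int_lattice" for k
    proof -
      have "k + (a - b) \<in> int_lattice"
        using \<open>a - b \<in> _\<close> that int_lattice_add by blast
      then have "infdist a int_lattice \<le> dist a (k + (a - b))"
        by (rule infdist_le)
      also have "\<dots> = dist b k"
        by (simp add: dist_norm)
      finally show ?thesis .
    qed
    then show ?thesis
      using ne by (simp add: infdist_notempty cINF_greatest)
  qed
  have "y - x \<in> int_lattice"
    using int_lattice_minus[OF assms] by simp
  then show ?thesis
    using *[OF assms] *[of y x] by simp
qed

instantiation torus :: (finite) metric_space
begin

text \<open>The distance of two cosets is the smallest Euclidean distance between representatives.\<close>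

lift_definition dist_torus :: "'a torus \<Rightarrow> 'a torus \<Rightarrow> real" is
  "\<lambda>x y. infdist (x - y) int_lattice"
proof -
  fix x x' y y' :: "real ^ 'a"
  assume "lattice_eq x x'" "lattice_eq y y'"
  then have "(x - x') - (y - y') \<in> int_lattice"
    unfolding lattice_eq_def by (rule int_lattice_diff)
  then have "(x - y) - (x' - y') \<in> int_lattice"
    by (simp add: algebra_simps)
  then show "infdist (x - y) int_lattice = infdist (x' - y') int_lattice"
    by (rule infdist_lattice_cong)
qed

definition uniformity_torus :: "('a torus \<times> 'a torus) filter" where
  "uniformity_torus = (INF e\<in>{0 <..}. principal {(x, y). dist x y < e})"

definition open_torus :: "'a torus set \<Rightarrow> bool" where
  "open_torus U \<longleftrightarrow> (\<forall>x\<in>U. \<forall>\<^sub>F (x', y) in uniformity. x' = x \<longrightarrow> y \<in> U)"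

instance
proof
  fix x y z :: "'a torus"
  have ne: "int_lattice \<noteq> ({} :: (real ^ 'a) set)"
    using int_lattice_0 by blast
  show "dist x y = 0 \<longleftrightarrow> x = y"
    by transfer (use ne in \<open>simp add: lattice_eq_def
        in_closed_iff_infdist_zero[OF closed_int_lattice]\<close>)
  show "dist x y \<le> dist x z + dist y z"
  proof transfer
    fix x y z :: "real ^ 'a"
    have le: "infdist (x - y) int_lattice \<le> dist (x - z) k + dist (y - z) l"
      if "k \<in> int_lattice" "l \<in> int_lattice" for k l
    proof -
      have "infdist (x - y) int_lattice \<le> dist (x - y) (k - l)"
        using that by (intro infdist_le int_lattice_diff)
      also have "\<dots> = norm ((x - z - k) - (y - z - l))"
        by (simp add: dist_norm algebra_simps)
      also have "\<dots> \<le> dist (x - z) k + dist (y - z) l"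
        unfolding dist_norm by (rule norm_triangle_ineq4)
      finally show ?thesis .
    qed
    have "infdist (x - y) int_lattice - dist (y - z) l \<le> infdist (x - z) int_lattice"
      if "l \<in> int_lattice" for l
      unfolding infdist_notempty[OF ne, of "x - z"]
      using le that ne by (intro cINF_greatest) (auto simp: algebra_simps)
    then have "infdist (x - y) int_lattice - infdist (x - z) int_lattice
        \<le> infdist (y - z) int_lattice"
      unfolding infdist_notempty[OF ne, of "y - z"]
      using ne by (intro cINF_greatest) (auto simp: algebra_simps)
    then show "infdist (x - y) int_lattice
        \<le> infdist (x - z) int_lattice + infdist (y - z) int_lattice"
      by simp
  qed
qed (simp_all add: uniformity_torus_def open_torus_def)

end

lemma dist_torus_proj_le: "dist (torus_proj x) (torus_proj y) \<le> dist x y"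
  using infdist_le[OF int_lattice_0, of "x - y"]
  by (simp add: dist_torus.abs_eq dist_norm)

lemma continuous_on_torus_proj: "continuous_on S torus_proj"
  unfolding continuous_on_iff using dist_torus_proj_le by (meson le_less_trans)

text \<open>Haar probability measure: Lebesgue measure of the half-open unit cube, which is a
  fundamental domain, pushed forward to the torus.\<close>

definition torus_lebesgue :: "('n::finite) torus measure" where
  "torus_lebesgue =
    distr (restrict_space lborel {x. \<forall>i. 0 \<le> x $ i \<and> x $ i < 1}) borel torus_proj"

definition hoelder_continuous :: "('a::metric_space \<Rightarrow> real) \<Rightarrow> bool" where
  "hoelder_continuous \<phi> \<longleftrightarrow>
    (\<exists>C \<alpha>. 0 < \<alpha> \<and> \<alpha> \<le> 1 \<and> (\<forall>x y. \<bar>\<phi> x - \<phi> y\<bar> \<le> C * dist x y powr \<alpha>))"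


section \<open>Differentiable maps of the torus\<close>

text \<open>The charts are the local inverses of \<^const>\<open>torus_proj\<close>, so a local representation of
  \<open>f\<close> in charts is a local lift \<open>F\<close>, and all tangent spaces are identified with the
  Euclidean space carrying its standard inner product.\<close>

definition lifts_on :: "(real ^ 'n::finite) set \<Rightarrow> (real ^ 'n \<Rightarrow> real ^ 'n)
    \<Rightarrow> ('n torus \<Rightarrow> 'n torus) \<Rightarrow> bool" where
  "lifts_on U F f \<longleftrightarrow> (\<forall>v\<in>U. torus_proj (F v) = f (torus_proj v))"

definition has_torus_derivative ::
    "('n::finite torus \<Rightarrow> 'n torus) \<Rightarrow> real ^ 'n ^ 'n \<Rightarrow> 'n torus \<Rightarrow> bool" where
  "has_torus_derivative f D p \<longleftrightarrow>
    (\<exists>F U x. torus_proj x = p \<and> open U \<and> x \<in> U \<and> lifts_on U F f \<and>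
       (F has_derivative (\<lambda>v. D *v v)) (at x))"

definition torus_deriv :: "('n::finite torus \<Rightarrow> 'n torus) \<Rightarrow> 'n torus \<Rightarrow> real ^ 'n ^ 'n" where
  "torus_deriv f p = (THE D. has_torus_derivative f D p)"

definition C2_on :: "'a::real_normed_vector set \<Rightarrow> ('a \<Rightarrow> 'b::real_normed_vector) \<Rightarrow> bool" where
  "C2_on U F \<longleftrightarrow>
    (\<exists>(F' :: 'a \<Rightarrow> 'a \<Rightarrow>\<^sub>L 'b) (F'' :: 'a \<Rightarrow> 'a \<Rightarrow>\<^sub>L ('a \<Rightarrow>\<^sub>L 'b)).
       (\<forall>x\<in>U. (F has_derivative blinfun_apply (F' x)) (at x)) \<and>
       (\<forall>x\<in>U. (F' has_derivative blinfun_apply (F'' x)) (at x)) \<and>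
       continuous_on U F'')"

definition torus_C2 :: "('n::finite torus \<Rightarrow> 'n torus) \<Rightarrow> bool" where
  "torus_C2 f \<longleftrightarrow> (\<forall>x. \<exists>F U. open U \<and> x \<in> U \<and> lifts_on U F f \<and> C2_on U F)"


section \<open>Hyperbolic toral endomorphisms\<close>

definition eigenvalue_of :: "int ^ 'n ^ 'n::finite \<Rightarrow> complex \<Rightarrow> bool" where
  "eigenvalue_of A c \<longleftrightarrow>
    (\<exists>v :: complex ^ 'n. v \<noteq> 0 \<and> map_matrix of_int A *v v = c *s v)"

definition hyperbolic_matrix :: "int ^ 'n ^ 'n::finite \<Rightarrow> bool" where
  "hyperbolic_matrix A \<longleftrightarrow>
    (\<forall>c. eigenvalue_of A c \<longrightarrow> cmod c \<noteq> 1) \<and> (\<exists>c. eigenvalue_of A c \<and> cmod c < 1)"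

lift_definition toral_endo :: "int ^ 'n ^ 'n::finite \<Rightarrow> 'n torus \<Rightarrow> 'n torus" is
  "\<lambda>A (x :: real ^ 'n). map_matrix of_int A *v x"
proof -
  fix A :: "int ^ 'n ^ 'n" and x y :: "real ^ 'n"
  assume "lattice_eq x y"
  then have "(map_matrix of_int A *v (x - y)) $ i \<in> \<int>" for i
    unfolding matrix_vector_mult_def lattice_eq_def int_lattice_def
    by (auto intro!: Ints_sum Ints_mult simp del: vector_minus_component)
  then show "lattice_eq (map_matrix of_int A *v x) (map_matrix of_int A *v y)"
    by (simp add: lattice_eq_def int_lattice_def matrix_vector_mult_diff_distrib)
qed


section \<open>Anosov endomorphisms\<close>

definition inverse_limit :: "('a \<Rightarrow> 'a) \<Rightarrow> (nat \<Rightarrow> 'a) set" where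
  "inverse_limit f = {h. \<forall>i. f (h (Suc i)) = h i}"

definition shift_hist :: "('a \<Rightarrow> 'a) \<Rightarrow> (nat \<Rightarrow> 'a) \<Rightarrow> nat \<Rightarrow> 'a" where
  "shift_hist f h = case_nat (f (h 0)) h"

text \<open>Continuous field of subspaces: locally spanned by a continuous frame.\<close>

definition continuous_subspaces ::
    "'a::topological_space set \<Rightarrow> ('a \<Rightarrow> (real ^ 'n::finite) set) \<Rightarrow> bool" where
  "continuous_subspaces S E \<longleftrightarrow>
    (\<forall>p\<in>S. \<exists>U k (b :: nat \<Rightarrow> 'a \<Rightarrow> real ^ 'n). open U \<and> p \<in> U \<and>
       (\<forall>i<k. continuous_on (S \<inter> U) (b i)) \<and>
       (\<forall>q\<in>S \<inter> U. inj_on (\<lambda>i. b i q) {..<k} \<and> independent ((\<lambda>i. b i q) ` {..<k}) \<and>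
          span ((\<lambda>i. b i q) ` {..<k}) = E q))"

text \<open>The inverse limit carries the product topology. The unstable space depends on the whole
  prehistory \<open>h\<close>, the stable one only on the base point \<open>h 0\<close>.\<close>

definition anosov_endomorphism :: "('n::finite torus \<Rightarrow> 'n torus) \<Rightarrow> bool" where
  "anosov_endomorphism f \<longleftrightarrow>
    (\<exists>(Es :: 'n torus \<Rightarrow> (real ^ 'n) set) (Eu :: (nat \<Rightarrow> 'n torus) \<Rightarrow> (real ^ 'n) set) C r.
       (\<forall>h\<in>inverse_limit f. subspace (Es (h 0)) \<and> subspace (Eu h) \<and>
          Es (h 0) \<inter> Eu h = {0} \<and> {v + w |v w. v \<in> Es (h 0) \<and> w \<in> Eu h} = UNIV) \<and>
       continuous_subspaces (inverse_limit f) (\<lambda>h. Es (h 0)) \<and>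
       continuous_subspaces (inverse_limit f) Eu \<and>
       (\<forall>h\<in>inverse_limit f. (\<lambda>v. torus_deriv f (h 0) *v v) ` Es (h 0) \<subseteq> Es (f (h 0))) \<and>
       (\<forall>h\<in>inverse_limit f. (\<lambda>v. torus_deriv f (h 0) *v v) ` Eu h = Eu (shift_hist f h)) \<and>
       0 < C \<and> 0 < r \<and> r < 1 \<and>
       (\<forall>h\<in>inverse_limit f. \<forall>n. \<forall>v\<in>Es (h 0).
          norm (torus_deriv (f ^^ n) (h 0) *v v) \<le> C * r ^ n * norm v) \<and>
       (\<forall>h\<in>inverse_limit f. \<forall>n. \<forall>v\<in>Eu h.
          norm v \<le> C * r ^ n * norm (torus_deriv (f ^^ n) (h 0) *v v)) \<and>
       (\<forall>h\<in>inverse_limit f. Es (h 0) \<noteq> {0}))"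

definition topologically_transitive :: "('a::topological_space \<Rightarrow> 'a) \<Rightarrow> bool" where
  "topologically_transitive f \<longleftrightarrow>
    (\<forall>U V. open U \<longrightarrow> U \<noteq> {} \<longrightarrow> open V \<longrightarrow> V \<noteq> {} \<longrightarrow> (\<exists>n. (f ^^ n) ` U \<inter> V \<noteq> {}))"


section \<open>Metric entropy and equilibrium measures\<close>

definition invariant_prob :: "('a::topological_space \<Rightarrow> 'a) \<Rightarrow> 'a measure \<Rightarrow> bool" where
  "invariant_prob f M \<longleftrightarrow>
    prob_space M \<and> sets M = sets borel \<and> f \<in> M \<rightarrow>\<^sub>M M \<and> distr M M f = M"

definition finite_partition :: "'a measure \<Rightarrow> 'a set set \<Rightarrow> bool" where
  "finite_partition M P \<longleftrightarrow> finite P \<and> P \<subseteq> sets M \<and> partition_on (space M) P"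

definition partition_entropy :: "'a measure \<Rightarrow> 'a set set \<Rightarrow> real" where
  "partition_entropy M P = - (\<Sum>a\<in>P. measure M a * ln (measure M a))"

text \<open>The common refinement of the preimages of \<open>P\<close> under the first \<open>n\<close> iterates.\<close>

definition iterated_join :: "('a \<Rightarrow> 'a) \<Rightarrow> 'a measure \<Rightarrow> 'a set set \<Rightarrow> nat \<Rightarrow> 'a set set" where
  "iterated_join f M P n =
    {space M \<inter> (\<Inter>i<n. (f ^^ i) -` a i) |a. \<forall>i<n. a i \<in> P} - {{}}"

text \<open>The limit exists for invariant \<open>M\<close>, by subadditivity.\<close>

definition entropy_wrt :: "('a \<Rightarrow> 'a) \<Rightarrow> 'a measure \<Rightarrow> 'a set set \<Rightarrow> real" where
  "entropy_wrt f M P = lim (\<lambda>n. partition_entropy M (iterated_join f M P n) / real n)"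

definition metric_entropy :: "('a \<Rightarrow> 'a) \<Rightarrow> 'a measure \<Rightarrow> ereal" where
  "metric_entropy f M = (SUP P\<in>{P. finite_partition M P}. ereal (entropy_wrt f M P))"

definition equilibrium_measure ::
    "('a::topological_space \<Rightarrow> 'a) \<Rightarrow> ('a \<Rightarrow> real) \<Rightarrow> 'a measure \<Rightarrow> bool" where
  "equilibrium_measure f \<phi> M \<longleftrightarrow> invariant_prob f M \<and>
    (\<forall>N. invariant_prob f N \<longrightarrow>
       metric_entropy f N + ereal (\<integral>x. \<phi> x \<partial>N) \<le> metric_entropy f M + ereal (\<integral>x. \<phi> x \<partial>M))"


section \<open>Folding entropy and entropy production\<close>

text \<open>Disintegration of \<open>M\<close> over the partition into fibres of \<open>f\<close>. Fibres are indexed by their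
  image point; for invariant \<open>M\<close> the factor measure on the set of fibres is then \<open>M\<close> itself.\<close>

definition fiber_disintegration :: "('a \<Rightarrow> 'a) \<Rightarrow> 'a measure \<Rightarrow> ('a \<Rightarrow> 'a measure) \<Rightarrow> bool" where
  "fiber_disintegration f M \<kappa> \<longleftrightarrow>
    \<kappa> \<in> M \<rightarrow>\<^sub>M prob_algebra M \<and>
    (AE x in M. emeasure (\<kappa> x) (f -` {x} \<inter> space M) = 1) \<and>
    (\<forall>B\<in>sets M. emeasure M B = (\<integral>\<^sup>+ x. emeasure (\<kappa> x) B \<partial>M))"

text \<open>By essential uniqueness of disintegrations the choice does not affect the folding entropy.\<close>

definition fiber_measure :: "('a \<Rightarrow> 'a) \<Rightarrow> 'a measure \<Rightarrow> 'a \<Rightarrow> 'a measure" where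
  "fiber_measure f M = (SOME \<kappa>. fiber_disintegration f M \<kappa>)"

text \<open>Extended values make the sum and the integral meaningful without finiteness
  assumptions; each summand is non-negative.\<close>

definition fiber_entropy :: "('a \<Rightarrow> 'a) \<Rightarrow> 'a measure \<Rightarrow> 'a \<Rightarrow> ennreal" where
  "fiber_entropy f M x = (\<Sum>\<^sub>\<infinity>y\<in>f -` {x} \<inter> space M.
     ennreal (- (measure (fiber_measure f M x) {y} * ln (measure (fiber_measure f M x) {y}))))"

definition folding_entropy :: "('a \<Rightarrow> 'a) \<Rightarrow> 'a measure \<Rightarrow> ennreal" where
  "folding_entropy f M = (\<integral>\<^sup>+ x. fiber_entropy f M x \<partial>M)"

definition entropy_production :: "('n::finite torus \<Rightarrow> 'n torus) \<Rightarrow> 'n torus measure \<Rightarrow> ereal" where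
  "entropy_production f M =
    enn2ereal (folding_entropy f M) - ereal (\<integral>x. ln \<bar>det (torus_deriv f x)\<bar> \<partial>M)"

end

theory Submission
  imports Defs
begin

text \<open>Only the invariance of the equilibrium measure matters. A local diffeomorphism of the torus
  is a finite covering, so all its fibres have the same number \<open>N\<close> of points, and the entropy of
  any probability on a fibre is at most \<open>ln N\<close>. If moreover \<open>\<bar>det Df\<bar>\<close> is a constant \<open>c\<close>, then
  \<open>f\<close> multiplies Haar measure by \<open>c\<close> on every set on which it is injective. Summing over a finite
  partition into such sets, Haar measure is multiplied by \<open>c / N\<close> under pull-back, so \<open>c = N\<close> and
  it is invariant; the same scaling shows that its conditional measures on fibres are uniform.\<close>

section \<open>The torus as a quotient of Euclidean space\<close>

text \<open>The integral of \<open>ln \<bar>det Df\<bar>\<close> against any probability is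
  \<open>ln c\<close>, so the bound \<open>ln N\<close> on folding entropy turns into non-positive
  entropy production through \<open>c = N\<close>; the equality for Haar measure thus feeds the
  inequality for all other measures. Linear and Anosov maps are treated alike: what is extracted
  from either is a local C1 lift with constant nonzero absolute Jacobian. The Jacobian formula lives
  in Euclidean space, so everything measured on the torus is carried up through
  \<open>torus_proj\<close>, injective on balls of radius 1/2. Images of Borel sets have to be Borel
  and inverse branches measurable; for this reason the pieces of injectivity are kept inside compact
  sets, on which a continuous injection is a homeomorphism onto its image. Conditional measures are
  never computed directly: their values on the pieces are recognised as densities, which are unique
  almost everywhere.\<close>

lemma norm_int_lattice_ge_1:
  fixes v :: "real ^ 'n::finite"
  assumes "v \<in> int_lattice" "v \<noteq> 0"
  shows "1 \<le> norm v"
proof -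
  obtain i where i: "v $ i \<noteq> 0" using assms(2) by (metis vec_eq_iff zero_index)
  have "v $ i \<in> \<int>" using assms(1) by (simp add: int_lattice_def)
  then have "1 \<le> \<bar>v $ i\<bar>" using i by (metis Ints_nonzero_abs_ge1)
  also have "\<dots> \<le> norm v" by (rule component_le_norm_cart)
  finally show ?thesis .
qed

lemma countable_int_lattice: "countable (int_lattice :: (real ^ 'n::finite) set)"
proof -
  have "v \<in> range (\<lambda>h :: 'n \<Rightarrow> int. (\<chi> i. of_int (h i)) :: real ^ 'n)" if "v \<in> int_lattice" for v
    by (rule image_eqI[of _ _ "\<lambda>i. floor (v $ i)"])
      (use that in \<open>auto simp: int_lattice_def vec_eq_iff elim!: Ints_cases\<close>)
  then show ?thesis
    by (meson countableI_type countable_image countable_subset subsetI)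
qed

lemma surj_torus_proj: "surj torus_proj"
  by (metis Quotient_abs_rep Quotient_torus surjI)

text \<open>Two points of such a ball are less than 1 apart, while nonzero lattice vectors have norm
  at least 1.\<close>

lemma inj_on_torus_proj_ball:
  fixes x :: "real ^ 'n::finite"
  shows "inj_on torus_proj (ball x (1/2))"
proof (rule inj_onI)
  fix u v :: "real ^ 'n"
  assume uv: "u \<in> ball x (1/2)" "v \<in> ball x (1/2)" "torus_proj u = torus_proj v"
  have "dist u v \<le> dist x u + dist x v" by (rule dist_triangle3)
  then have "norm (u - v) < 1" using uv by (simp add: dist_norm)
  moreover have "u - v \<in> int_lattice" using uv by (simp add: torus_proj_eq_iff)
  ultimately show "u = v" using norm_int_lattice_ge_1[of "u - v"] by force
qed

text \<open>The infimum that defines the torus distance is attained, because the lattice is closed.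
  Small distances on the torus are therefore realised upstairs with a prescribed base point, which
  makes the projection open.\<close>

lemma dist_torus_proj_lt_lift:
  assumes "dist (torus_proj x) q < e"
  obtains y where "torus_proj y = q" "dist x y < e"
proof -
  obtain z where z: "q = torus_proj z" using surj_torus_proj by (metis surjD)
  have ne: "int_lattice \<noteq> ({} :: (real ^ 'a) set)" using int_lattice_0 by blast
  obtain k where k: "k \<in> int_lattice" "infdist (x - z) int_lattice = dist (x - z) k"
    using infdist_attains_inf[OF closed_int_lattice ne] by blast
  show ?thesis
  proof
    show "torus_proj (z + k) = q" using k z by (simp add: torus_proj_eq_iff)
    show "dist x (z + k) < e" using assms k z
      by (simp add: dist_torus.abs_eq dist_norm algebra_simps)
  qed
qed

lemma open_torus_proj_image:
  assumes "open U" shows "open (torus_proj ` U)"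
  unfolding open_dist
proof (intro ballI)
  fix p assume "p \<in> torus_proj ` U"
  then obtain x where x: "x \<in> U" "p = torus_proj x" by blast
  obtain e where e: "e > 0" "ball x e \<subseteq> U" using assms x openE by blast
  have "q \<in> torus_proj ` U" if "dist q p < e" for q
  proof -
    have "dist (torus_proj x) q < e" using that x by (simp add: dist_commute)
    then obtain y where "torus_proj y = q" "dist x y < e"
      by (rule dist_torus_proj_lt_lift)
    then show ?thesis using e by auto
  qed
  then show "\<exists>e>0. \<forall>y. dist y p < e \<longrightarrow> y \<in> torus_proj ` U" using e by blast
qed

lemma compact_torus: "compact (UNIV :: 'n::finite torus set)"
proof -
  \<comment> \<open>Fractional parts give a representative with coordinates in [0,1); its norm is at
    most the sum of the coordinates, hence the radius.\<close>
  have "q \<in> torus_proj ` cball 0 (real CARD('n))" for q :: "'n torus"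
  proof -
    obtain z where z: "q = torus_proj z" using surj_torus_proj by (metis surjD)
    define y where "y = (\<chi> i. frac (z $ i))"
    have "torus_proj y = q"
      using z by (auto simp: torus_proj_eq_iff int_lattice_def y_def frac_def)
    moreover have "norm y \<le> (\<Sum>i\<in>UNIV. \<bar>y $ i\<bar>)" by (rule norm_le_l1_cart)
    moreover have "\<dots> \<le> (\<Sum>i\<in>(UNIV::'n set). 1)"
      by (rule sum_mono) (auto simp: y_def frac_lt_1 less_imp_le)
    ultimately show ?thesis by auto
  qed
  then have "UNIV = torus_proj ` cball (0 :: real ^ 'n) (real CARD('n))" by blast
  then show ?thesis
    using compact_continuous_image[OF continuous_on_torus_proj compact_cball] by metis
qed

lemma connected_torus: "connected (UNIV :: 'n::finite torus set)"
proof -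
  have "connected (range (torus_proj :: real ^ 'n \<Rightarrow> _))"
    by (intro connected_continuous_image continuous_on_torus_proj connected_UNIV)
  then show ?thesis by (simp only: surj_torus_proj)
qed

section \<open>Haar measure computed on arbitrary injectively projected sets\<close>

definition unit_cube :: "(real ^ 'n::finite) set" where
  "unit_cube = {x. \<forall>i. 0 \<le> x $ i \<and> x $ i < 1}"

lemma unit_cube_borel [measurable]: "unit_cube \<in> sets borel"
  unfolding unit_cube_def by measurable

lemma borel_measurable_torus_proj [measurable]: "torus_proj \<in> borel_measurable borel"
  by (intro borel_measurable_continuous_onI continuous_on_torus_proj)

lemma sets_torus_lebesgue [simp, measurable_cong]: "sets torus_lebesgue = sets borel"
  and space_torus_lebesgue [simp]: "space torus_lebesgue = UNIV"
  by (simp_all add: torus_lebesgue_def)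

lemma emeasure_torus_lebesgue:
  assumes [measurable]: "B \<in> sets borel"
  shows "emeasure torus_lebesgue B = emeasure lborel (unit_cube \<inter> torus_proj -` B)"
proof -
  have [measurable]: "torus_proj -` B \<in> sets borel"
    using measurable_sets[OF borel_measurable_torus_proj assms] by simp
  show ?thesis
  unfolding torus_lebesgue_def unit_cube_def[symmetric]
  by (subst emeasure_distr)
     (auto simp: space_restrict_space emeasure_restrict_space Int_commute
       intro!: measurable_restrict_space1)
qed

lemma emeasure_lborel_unit_cube: "emeasure lborel (unit_cube :: (real ^ 'n::finite) set) = 1"
proof -
  have c: "emeasure lborel (cbox 0 (1 :: real ^ 'n)) = 1" "emeasure lborel (box 0 (1 :: real ^ 'n)) = 1"
    by (auto simp: emeasure_lborel_cbox_eq emeasure_lborel_box_eq Basis_vec_def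
      inner_axis intro!: prod.neutral)
  have "box 0 1 \<subseteq> (unit_cube :: (real ^ 'n) set)" "unit_cube \<subseteq> cbox 0 (1 :: real ^ 'n)"
    by (auto simp: unit_cube_def mem_box_cart less_imp_le)
  then show ?thesis
    using c emeasure_mono[of "box 0 1" "unit_cube :: (real ^ 'n) set" lborel]
      emeasure_mono[of "unit_cube :: (real ^ 'n) set" "cbox 0 1" lborel] by auto
qed

lemma prob_space_torus_lebesgue: "prob_space torus_lebesgue"
  by (rule prob_spaceI) (simp add: emeasure_torus_lebesgue emeasure_lborel_unit_cube)

lemma emeasure_lborel_translate:
  fixes S :: "('a :: euclidean_space) set"
  assumes "S \<in> sets borel"
  shows "emeasure lborel ((+) k -` S) = emeasure lborel S"
proof -
  have "emeasure lborel S = emeasure (distr lborel borel ((+) k)) S"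
    by (simp add: lborel_distr_plus)
  also have "\<dots> = emeasure lborel ((+) k -` S)"
    by (subst emeasure_distr) (use assms in auto)
  finally show ?thesis by simp
qed

text \<open>Haar measure does not depend on the fundamental domain: the part of the cube over the
  image is cut into pieces, one for each lattice vector \<open>k\<close>, and translating the pieces
  by \<open>k\<close> reassembles \<open>S\<close>. Injectivity keeps the pieces in the cube
  disjoint; the half-open form of the cube makes its translates tile the space, so the pieces in
  \<open>S\<close> are disjoint and exhaust it.\<close>

lemma emeasure_torus_lebesgue_proj:
  fixes S :: "(real ^ 'n::finite) set"
  assumes [measurable]: "S \<in> sets borel" "torus_proj ` S \<in> sets borel"
    and inj: "inj_on torus_proj S"
  shows "emeasure torus_lebesgue (torus_proj ` S) = emeasure lborel S"
proof -
  have tr: "(+) k -` T \<in> sets borel" if "T \<in> sets borel" for k and T :: "(real ^ 'n) set"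
    using measurable_sets[of "(+) k" borel borel T] that by simp
  have "emeasure torus_lebesgue (torus_proj ` S)
      = emeasure lborel (unit_cube \<inter> torus_proj -` (torus_proj ` S))"
    by (rule emeasure_torus_lebesgue) fact
  also have "unit_cube \<inter> torus_proj -` (torus_proj ` S) =
      (\<Union>k\<in>int_lattice. unit_cube \<inter> (+) k -` S)" (is "?L = ?R")
  proof (intro equalityI subsetI)
    fix v assume v: "v \<in> ?L"
    then obtain s where s: "s \<in> S" "torus_proj s = torus_proj v" by force
    have "s - v \<in> int_lattice" using s by (simp add: torus_proj_eq_iff)
    moreover have "(s - v) + v \<in> S" using s by simp
    ultimately show "v \<in> ?R" using v by blast
  next
    fix v assume "v \<in> ?R"
    then obtain k where k: "k \<in> int_lattice" "v \<in> unit_cube" "k + v \<in> S" by blast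
    have "torus_proj v = torus_proj (k + v)" 
      using k int_lattice_minus by (simp add: torus_proj_eq_iff)
    then show "v \<in> ?L" using k by blast
  qed
  also have "emeasure lborel \<dots> =
      (\<integral>\<^sup>+k. emeasure lborel (unit_cube \<inter> (+) k -` S) \<partial>count_space int_lattice)"
  proof (rule emeasure_UN_countable)
    show "disjoint_family_on (\<lambda>k. unit_cube \<inter> (+) k -` S) int_lattice"
    proof (unfold disjoint_family_on_def, intro ballI impI, rule ccontr)
      fix k l :: "real ^ 'n" assume kl: "k \<in> int_lattice" "l \<in> int_lattice" "k \<noteq> l"
        "unit_cube \<inter> (+) k -` S \<inter> (unit_cube \<inter> (+) l -` S) \<noteq> {}"
      then obtain v where v: "k + v \<in> S" "l + v \<in> S" by blast
      have "torus_proj (k + v) = torus_proj (l + v)"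
        using kl int_lattice_diff by (simp add: torus_proj_eq_iff)
      then have "k + v = l + v" using inj v by (metis inj_onD)
      then show False using kl by simp
    qed
  qed (use tr countable_int_lattice in auto)
  \<comment> \<open>Each piece is moved by its own vector \<open>k\<close>, out of the cube and into
    \<open>S\<close>.\<close>
  also have "\<dots> = (\<integral>\<^sup>+k. emeasure lborel ((+) (-k) -` unit_cube \<inter> S) \<partial>count_space int_lattice)"
  proof (rule nn_integral_cong)
    fix k :: "real ^ 'n"
    have "emeasure lborel ((+) (-k) -` (unit_cube \<inter> (+) k -` S)) =
        emeasure lborel (unit_cube \<inter> (+) k -` S)"
      by (rule emeasure_lborel_translate) (use tr in auto)
    moreover have "(+) (-k) -` (unit_cube \<inter> (+) k -` S) = (+) (-k) -` unit_cube \<inter> S" by auto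
    ultimately show "emeasure lborel (unit_cube \<inter> (+) k -` S) =
        emeasure lborel ((+) (-k) -` unit_cube \<inter> S)" by simp
  qed
  also have "\<dots> = emeasure lborel (\<Union>k\<in>int_lattice. (+) (-k) -` unit_cube \<inter> S)"
  proof (rule emeasure_UN_countable[symmetric])
    show "disjoint_family_on (\<lambda>k. (+) (-k) -` unit_cube \<inter> S) int_lattice"
    proof (unfold disjoint_family_on_def, intro ballI impI, rule ccontr)
      fix k l :: "real ^ 'n" assume kl: "k \<in> int_lattice" "l \<in> int_lattice" "k \<noteq> l"
        "(+) (-k) -` unit_cube \<inter> S \<inter> ((+) (-l) -` unit_cube \<inter> S) \<noteq> {}"
      then obtain v where v: "- k + v \<in> unit_cube" "- l + v \<in> unit_cube" by blast
      have "k $ i = l $ i" for i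
      proof -
        have "k $ i - l $ i \<in> \<int>" using kl by (auto simp: int_lattice_def)
        moreover have "\<bar>k $ i - l $ i\<bar> < 1" using v by (auto simp: unit_cube_def abs_less_iff) (smt (verit))+
        ultimately show ?thesis using Ints_nonzero_abs_less1 by fastforce
      qed
      then show False using kl by (simp add: vec_eq_iff)
    qed
  qed (use tr countable_int_lattice in auto)
  also have "(\<Union>k\<in>int_lattice. (+) (-k) -` unit_cube \<inter> S) = S"
  proof -
    have "\<exists>k\<in>int_lattice. - k + v \<in> unit_cube" for v :: "real ^ 'n"
      by (rule bexI[of _ "\<chi> i. of_int \<lfloor>v $ i\<rfloor>"])
        (auto simp: int_lattice_def unit_cube_def floor_less_one intro: floor_correct, linarith)
    then show ?thesis by auto
  qed
  finally show ?thesis .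
qed

text \<open>By continuity the values near \<open>a\<close> are closer than 1 to \<open>h a\<close>,
  and distinct lattice vectors are at least 1 apart. Applied to the difference of two lifts of the
  same map.\<close>

lemma lattice_valued_continuous_locally_const:
  fixes h :: "'a::metric_space \<Rightarrow> real ^ 'n::finite"
  assumes "\<forall>\<^sub>F x in at a. h x \<in> int_lattice" "h a \<in> int_lattice" "isCont h a"
  shows "\<forall>\<^sub>F x in at a. h x = h a"
proof -
  have "\<forall>\<^sub>F x in at a. dist (h x) (h a) < 1"
    using assms(3) by (auto simp: isCont_def intro: tendstoD)
  with assms(1) show ?thesis
  proof eventually_elim
    case (elim x)
    then have "h x - h a \<in> int_lattice" using assms(2) int_lattice_diff by blast
    then show ?case using elim(2) norm_int_lattice_ge_1[of "h x - h a"] by (force simp: dist_norm)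
  qed
qed

text \<open>This makes the definite description in \<open>torus_deriv\<close> meaningful. Two lifts,
  shifted to the same representative by a lattice vector \<open>k\<close>, differ by a continuous
  lattice-valued function; it is locally constant and has derivative 0.\<close>

lemma has_torus_derivative_unique:
  assumes "has_torus_derivative f D p" "has_torus_derivative f E p"
  shows "D = E"
proof -
  obtain F U x where F: "torus_proj x = p" "open U" "x \<in> U" "lifts_on U F f"
     "(F has_derivative (\<lambda>v. D *v v)) (at x)"
    using assms(1) unfolding has_torus_derivative_def by blast
  obtain G V y where G: "torus_proj y = p" "open V" "y \<in> V" "lifts_on V G f"
     "(G has_derivative (\<lambda>v. E *v v)) (at y)"
    using assms(2) unfolding has_torus_derivative_def by blast
  define k where "k = y - x"
  have k: "k \<in> int_lattice" using F(1) G(1) by (metis k_def torus_proj_eq_iff)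
  have G': "((\<lambda>v. G (v + k)) has_derivative (\<lambda>v. E *v v)) (at x)"
    by (rule has_derivative_compose[of "\<lambda>v. v + k" "\<lambda>v. v" x UNIV G])
       (use G(5) in \<open>auto simp: k_def intro!: derivative_eq_intros\<close>)
  define h where "h = (\<lambda>v. F v - G (v + k))"
  have h: "(h has_derivative (\<lambda>v. D *v v - E *v v)) (at x)"
    unfolding h_def by (rule has_derivative_diff[OF F(5) G'])
  have lat: "h v \<in> int_lattice" if "v \<in> U" "v + k \<in> V" for v
  proof -
    have "torus_proj (v + k) = torus_proj v" using k by (simp add: torus_proj_eq_iff)
    then show ?thesis using that F(4) G(4) unfolding lifts_on_def h_def
      by (metis torus_proj_eq_iff)
  qed
  have oV: "open ((\<lambda>v. v + k) -` V)" by (intro open_vimage G continuous_intros)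
  have "\<forall>\<^sub>F v in at x. h v \<in> int_lattice"
    using eventually_at_in_open'[OF F(2,3)] eventually_at_in_open'[OF oV, of x] G(3)
    by (auto simp: k_def elim: eventually_elim2 intro!: lat)
  moreover have "h x \<in> int_lattice" using lat F(3) G(3) by (simp add: k_def)
  moreover have "isCont h x" using h by (rule has_derivative_continuous)
  ultimately have "\<forall>\<^sub>F v in at x. h v = h x" by (rule lattice_valued_continuous_locally_const)
  then have "\<forall>\<^sub>F v in at x. h x = h v" by (simp only: eq_commute)
  then have "(h has_derivative (\<lambda>v. 0)) (at x)"
    by (rule has_derivative_transform_eventually[OF has_derivative_const]) auto
  then have "(\<lambda>v. D *v v - E *v v) = (\<lambda>v. 0)" by (rule has_derivative_unique[OF h])
  then have "D *v v = E *v v" for v by (metis eq_iff_diff_eq_0)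
  then show ?thesis by (simp add: matrix_eq)
qed

lemma torus_deriv_eq:
  assumes "has_torus_derivative f D p" shows "torus_deriv f p = D"
  unfolding torus_deriv_def using assms has_torus_derivative_unique by blast

section \<open>Change of variables with constant Jacobian\<close>

text \<open>The library's change of variables formula requires a well-ordered index type;
  this copy of an arbitrary finite type carries an arbitrarily chosen well-order.\<close>

typedef 'a ordered_copy = "UNIV :: 'a set" by simp

instance ordered_copy :: (finite) finite
proof
  have "surj (Abs_ordered_copy :: 'a \<Rightarrow> _)"
    by (metis Rep_ordered_copy_inverse surjI)
  then show "finite (UNIV :: 'a ordered_copy set)"
    using finite_imageI[OF finite_class.finite_UNIV, of "Abs_ordered_copy :: 'a \<Rightarrow> _"] by simp
qed

definition copy_index :: "'a::finite ordered_copy \<Rightarrow> nat" where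
  "copy_index = (SOME h. inj h)"

lemma inj_copy_index: "inj (copy_index :: 'a::finite ordered_copy \<Rightarrow> nat)"
proof -
  obtain h :: "'a ordered_copy \<Rightarrow> nat" where "inj h"
    using finite_imp_inj_to_nat_seg[OF finite_class.finite_UNIV] by metis
  then show ?thesis unfolding copy_index_def by (rule someI[of inj])
qed

instantiation ordered_copy :: (finite) wellorder
begin

definition "x \<le> y \<longleftrightarrow> copy_index x \<le> copy_index y"
definition "x < y \<longleftrightarrow> copy_index x < copy_index y"

instance
proof
  fix x y :: "'a ordered_copy"
  show "x \<le> y \<Longrightarrow> y \<le> x \<Longrightarrow> x = y"
    by (simp add: less_eq_ordered_copy_def inj_eq[OF inj_copy_index])
next
  fix P :: "'a ordered_copy \<Rightarrow> bool" and a
  assume *: "\<And>x. (\<And>y. y < x \<Longrightarrow> P y) \<Longrightarrow> P x"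
  show "P a"
    by (induction "copy_index a" arbitrary: a rule: less_induct)
      (use * in \<open>auto simp: less_ordered_copy_def\<close>)
qed (auto simp: less_eq_ordered_copy_def less_ordered_copy_def)

end

section \<open>Relabelling coordinates preserves determinants and Lebesgue measure\<close>

lemma bij_Rep_ordered_copy: "bij Rep_ordered_copy"
  by (rule bij_betw_byWitness[where f' = Abs_ordered_copy])
    (simp_all add: Abs_ordered_copy_inverse Rep_ordered_copy_inverse)

text \<open>Conjugation by \<open>h\<close> is a sign-preserving bijection between the permutations
  of the two index types, and it matches the two Leibniz sums term by term.\<close>

lemma det_reindex:
  fixes A :: "'a::comm_ring_1 ^ 'n::finite ^ 'n" and h :: "'m::finite \<Rightarrow> 'n"
  assumes h: "bij h"
  shows "det (\<chi> i j. A $ h i $ h j :: 'a ^ 'm ^ 'm) = det A"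
proof -
  have inj: "inj_on h UNIV" using h by (rule bij_is_inj)
  have bb: "bij_betw (map_permutation UNIV h) {p. p permutes (UNIV::'m set)} {q. q permutes (UNIV::'n set)}"
  proof (rule bij_betw_byWitness[where f' = "map_permutation UNIV (inv h)"])
    have hi: "bij (inv h)" "\<And>x. inv h (h x) = x" "\<And>y. h (inv h y) = y"
      using h by (simp_all add: bij_imp_bij_inv bij_is_inj bij_is_surj surj_f_inv_f)
    show "\<forall>p\<in>{p. p permutes UNIV}. map_permutation UNIV (inv h) (map_permutation UNIV h p) = p"
      "\<forall>q\<in>{q. q permutes UNIV}. map_permutation UNIV h (map_permutation UNIV (inv h) q) = q"
      using h hi by (auto intro!: map_permutation_compose_inv)
    show "map_permutation UNIV h ` {p. p permutes UNIV} \<subseteq> {q. q permutes UNIV}"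
      "map_permutation UNIV (inv h) ` {q. q permutes UNIV} \<subseteq> {p. p permutes UNIV}"
      using h hi by (auto intro!: map_permutation_permutes)
  qed
  have term_eq: "of_int (sign p) * (\<Prod>i\<in>UNIV. (\<chi> i j. A $ h i $ h j :: 'a ^ 'm ^ 'm) $ i $ p i) =
      of_int (sign (map_permutation UNIV h p)) * (\<Prod>i\<in>UNIV. A $ i $ map_permutation UNIV h p i)"
    if "p permutes UNIV" for p
  proof -
    have "(\<Prod>i\<in>UNIV. A $ i $ map_permutation UNIV h p i) =
      (\<Prod>i\<in>UNIV. A $ h i $ map_permutation UNIV h p (h i))"
      by (rule prod.reindex_bij_betw[OF h, symmetric])
    then show ?thesis
      using that inj by (simp add: sign_map_permutation map_permutation_apply)
  qed
  show ?thesis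
    unfolding det_def sum.reindex_bij_betw[OF bb, symmetric]
    by (rule sum.cong) (use term_eq in auto)
qed

definition reindex :: "('m \<Rightarrow> 'n) \<Rightarrow> 'a ^ 'n \<Rightarrow> 'a ^ 'm" where
  "reindex h v = (\<chi> i. v $ h i)"

lemma linear_reindex: "linear (reindex h :: real ^ 'n::finite \<Rightarrow> real ^ 'm::finite)"
  by (rule linearI) (auto simp: reindex_def vec_eq_iff)

lemma reindex_inv:
  assumes "bij h"
  shows "reindex (inv h) (reindex h v) = v" "reindex h (reindex (inv h) w) = w"
  using assms by (simp_all add: reindex_def vec_eq_iff bij_is_surj surj_f_inv_f bij_is_inj)

lemma reindex_measurable [measurable]:
  "(reindex h :: real ^ 'n::finite \<Rightarrow> real ^ 'm::finite) \<in> borel_measurable borel"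
  by (intro borel_measurable_continuous_onI linear_continuous_on
      linear_conv_bounded_linear[THEN iffD1] linear_reindex)

lemma emeasure_lborel_box_cart:
  fixes l u :: "real ^ 'n::finite"
  assumes "\<And>i. l $ i \<le> u $ i"
  shows "emeasure lborel (box l u) = (\<Prod>i\<in>UNIV. ennreal (u $ i - l $ i))"
proof -
  have *: "(\<Prod>b\<in>Basis. (u - l) \<bullet> b) = (\<Prod>i\<in>UNIV. (u - l) $ i)"
  proof -
    have B: "(Basis :: (real ^ 'n) set) = range (\<lambda>i. axis i (1::real))" by (auto simp: Basis_vec_def)
    have "inj (\<lambda>i. axis i (1::real) :: real ^ 'n)" by (auto simp: inj_def axis_eq_axis)
    then show ?thesis unfolding B by (subst prod.reindex) (simp_all add: inner_axis)
  qed
  have "\<forall>b\<in>Basis. l \<bullet> b \<le> u \<bullet> b" using assms by (auto simp: Basis_vec_def inner_axis)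
  then show ?thesis
    using assms by (simp add: emeasure_lborel_box_eq * prod_ennreal)
qed

text \<open>Lebesgue measure is determined by its values on boxes, and relabelling only permutes the
  side lengths of a box.\<close>

lemma distr_reindex_lborel:
  assumes h: "bij (h :: 'm::finite \<Rightarrow> 'n::finite)"
  shows "distr lborel borel (reindex h :: real ^ 'n \<Rightarrow> real ^ 'm) = lborel"
proof (rule lborel_eqI[symmetric])
  fix l u :: "real ^ 'm"
  assume lu: "\<And>b. b \<in> Basis \<Longrightarrow> l \<bullet> b \<le> u \<bullet> b"
  have lu': "l $ i \<le> u $ i" for i
    using lu[of "axis i 1"] by (simp add: inner_axis axis_in_Basis_iff)
  have "emeasure (distr lborel borel (reindex h)) (box l u) = emeasure lborel (reindex h -` box l u)"
    by (subst emeasure_distr) auto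
  also have "reindex h -` box l u = box (reindex (inv h) l) (reindex (inv h) u)" 
  proof -
    have "(\<forall>i. l $ i < v $ h i \<and> v $ h i < u $ i) \<longleftrightarrow>
          (\<forall>j. l $ inv h j < v $ j \<and> v $ j < u $ inv h j)" for v :: "real ^ 'n"
      using h by (metis bij_inv_eq_iff)
    then show ?thesis by (auto simp: mem_box_cart reindex_def)
  qed
  also have "emeasure lborel \<dots> = (\<Prod>j\<in>UNIV. ennreal (u $ inv h j - l $ inv h j))"
    using lu' by (subst emeasure_lborel_box_cart) (auto simp: reindex_def)
  also have "\<dots> = (\<Prod>i\<in>UNIV. ennreal (u $ i - l $ i))"
    by (rule prod.reindex_bij_betw[of "inv h"]) (use h in \<open>simp add: bij_imp_bij_inv\<close>)
  also have "\<dots> = emeasure lborel (box l u)"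
    using lu' by (subst emeasure_lborel_box_cart) auto
  also have "\<dots> = ennreal (\<Prod>b\<in>Basis. (u - l) \<bullet> b)"
    using lu by (simp add: emeasure_lborel_box_eq)
  finally show "emeasure (distr lborel borel (reindex h)) (box l u) = (\<Prod>b\<in>Basis. (u - l) \<bullet> b)" .
qed simp

lemma emeasure_reindex_image:
  assumes h: "bij (h :: 'm::finite \<Rightarrow> 'n::finite)" and S: "S \<in> sets borel"
  shows "reindex h ` S \<in> sets borel"
    "emeasure lborel (reindex h ` S :: (real ^ 'm) set) = emeasure lborel (S :: (real ^ 'n) set)"
proof -
  have eq: "reindex h ` S = reindex (inv h) -` S"
    by (auto simp: reindex_inv[OF h] image_iff) (metis reindex_inv(2)[OF h])
  show *: "reindex h ` S \<in> sets borel"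
    unfolding eq using measurable_sets[OF reindex_measurable S] by simp
  have "emeasure lborel (reindex h ` S :: (real ^ 'm) set)
      = emeasure (distr lborel borel (reindex h)) (reindex h ` S :: (real ^ 'm) set)"
    by (simp add: distr_reindex_lborel[OF h])
  also have "\<dots> = emeasure lborel (reindex h -` (reindex h ` S))"
    using * by (subst emeasure_distr) auto
  also have "reindex h -` (reindex h ` S) = S"
    by auto (metis reindex_inv(1)[OF h])
  finally show "emeasure lborel (reindex h ` S) = emeasure lborel S" .
qed

text \<open>Change of variables with integrand the constant \<open>c\<close>. Finite measure of
  \<open>S\<close> makes the constant integrable; since \<open>S\<close> and its image are Borel,
  the result for the completed measure is also one for \<open>lborel\<close>.\<close>

lemma emeasure_image_const_det_wellorder:
  fixes f :: "real ^ 'n::{finite,wellorder} \<Rightarrow> real ^ 'n::_"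
  assumes S: "S \<in> sets borel" and fS: "f ` S \<in> sets borel" and fin: "emeasure lborel S < \<infinity>"
    and der: "\<And>x. x \<in> S \<Longrightarrow> (f has_derivative f' x) (at x within S)"
    and inj: "inj_on f S" and det: "\<And>x. x \<in> S \<Longrightarrow> \<bar>det (matrix (f' x))\<bar> = c"
  shows "emeasure lborel (f ` S) = ennreal c * emeasure lborel S"
proof -
  have Sl: "S \<in> sets lebesgue" using S by (metis sets_completionI_sets sets_lborel)
  have lm: "S \<in> lmeasurable" using Sl fin S by (auto simp: fmeasurable_def)
  have I: "((\<lambda>x. c) has_integral (c * measure lebesgue S)) S"
  proof -
    have "((\<lambda>x. 1) has_integral measure lebesgue S) S"
      using lm lmeasurable_iff_integrable_on lmeasure_integral integrable_integral by metis
    then show ?thesis using has_integral_mult_right[of "\<lambda>x. 1 :: real" "measure lebesgue S" S c] by simp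
  qed
  have int: "(\<lambda>x. \<bar>det (matrix (f' x))\<bar>) integrable_on S"
    by (rule integrable_eq[of "\<lambda>x. c"]) (use I det in auto)
  have "f ` S \<in> lmeasurable"
    using measurable_differentiable_image_eq[OF Sl der inj] int by blast
  then have "emeasure lebesgue (f ` S) = measure lebesgue (f ` S)"
    by (intro emeasure_eq_ennreal_measure fmeasurableD2)
  also have "measure lebesgue (f ` S) = integral S (\<lambda>x. \<bar>det (matrix (f' x))\<bar>)"
    by (rule measure_differentiable_image_eq[OF Sl der inj int])
  also have "\<dots> = integral S (\<lambda>x. c)" by (rule integral_cong) (rule det)
  also have "\<dots> = c * measure lebesgue S" using I by (rule integral_unique)
  also have "ennreal \<dots> = ennreal c * ennreal (measure lebesgue S)" by (rule ennreal_mult'') simp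
  also have "ennreal (measure lebesgue S) = emeasure lebesgue S"
    using emeasure_eq_ennreal_measure[OF fmeasurableD2[OF lm]] by (rule sym)
  finally show ?thesis using S fS by simp
qed

text \<open>The map is conjugated with the relabelling \<open>R\<close> onto the well-ordered copy
  of the index type. This changes neither the measures of \<open>S\<close> and its image nor the
  absolute Jacobian.\<close>

lemma emeasure_image_const_det:
  fixes f :: "real ^ 'n::finite \<Rightarrow> real ^ 'n"
  assumes S: "S \<in> sets borel" and fS: "f ` S \<in> sets borel" and fin: "emeasure lborel S < \<infinity>"
    and der: "\<And>x. x \<in> S \<Longrightarrow> (f has_derivative f' x) (at x)"
    and inj: "inj_on f S" and det: "\<And>x. x \<in> S \<Longrightarrow> \<bar>det (matrix (f' x))\<bar> = c"
  shows "emeasure lborel (f ` S) = ennreal c * emeasure lborel S"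
proof -
  define h where "h = (Rep_ordered_copy :: 'n ordered_copy \<Rightarrow> 'n)"
  have h: "bij h" unfolding h_def by (rule bij_Rep_ordered_copy)
  note inv = reindex_inv[OF h]
  note bl = linear_conv_bounded_linear[THEN iffD1, OF linear_reindex]
  define R where "R = (reindex h :: real ^ 'n \<Rightarrow> real ^ 'n ordered_copy)"
  define Q where "Q = (reindex (inv h) :: real ^ 'n ordered_copy \<Rightarrow> real ^ 'n)"
  have QR: "Q (R v) = v" "R (Q w) = w" for v w by (simp_all add: Q_def R_def inv)
  have img: "(R \<circ> f \<circ> Q) ` (R ` S) = R ` (f ` S)"
    by (simp add: image_image QR)
  have "emeasure lborel ((R \<circ> f \<circ> Q) ` (R ` S)) = ennreal c * emeasure lborel (R ` S)"
  proof (rule emeasure_image_const_det_wellorder)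
    show "R ` S \<in> sets borel" "emeasure lborel (R ` S) < \<infinity>"
      using emeasure_reindex_image[OF h S] fin by (simp_all add: R_def)
    show "(R \<circ> f \<circ> Q) ` R ` S \<in> sets borel"
      unfolding img using emeasure_reindex_image[OF h fS] by (simp add: R_def)
    show "inj_on (R \<circ> f \<circ> Q) (R ` S)"
      using inj by (auto simp: inj_on_def QR) (metis QR(1))
  next
    fix w assume "w \<in> R ` S"
    then have Qw: "Q w \<in> S" by (auto simp: QR)
    have "(Q has_derivative Q) (at w)"
      unfolding Q_def by (rule bounded_linear_imp_has_derivative[OF bl])
    moreover have "(R has_derivative R) (at (f (Q w)))"
      unfolding R_def by (rule bounded_linear_imp_has_derivative[OF bl])
    ultimately have "(R \<circ> f \<circ> Q has_derivative R \<circ> f' (Q w) \<circ> Q) (at w)"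
      using der[OF Qw] by (intro diff_chain_at) simp_all
    then show "(R \<circ> f \<circ> Q has_derivative R \<circ> f' (Q w) \<circ> Q) (at w within R ` S)"
      by (rule has_derivative_at_withinI)
    \<comment> \<open>Relabelling permutes the standard basis, so the matrix of the conjugated
      derivative is the old one with rows and columns renamed by \<open>h\<close>.\<close>
    have "Q (axis j 1) = axis (h j) 1" for j
    proof -
      have "(inv h i = j) = (i = h j)" for i using bij_inv_eq_iff[OF h, of j i] by metis
      then show ?thesis by (simp add: Q_def reindex_def axis_def vec_eq_iff)
    qed
    then have "matrix (R \<circ> f' (Q w) \<circ> Q) = (\<chi> i j. matrix (f' (Q w)) $ h i $ h j)"
      by (simp add: matrix_def R_def reindex_def)
    then show "\<bar>det (matrix (R \<circ> f' (Q w) \<circ> Q))\<bar> = c"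
      using det[OF Qw] by (simp add: det_reindex[OF h])
  qed
  then show ?thesis
    unfolding img using emeasure_reindex_image[OF h S] emeasure_reindex_image[OF h fS]
    by (simp add: R_def)
qed

section \<open>Local lifts\<close>

lemma borel_continuous_preimage:
  assumes "continuous_on A g" "A \<in> sets borel" "S \<in> sets borel"
  shows "A \<inter> g -` S \<in> sets borel"
proof -
  have "g -` S \<inter> space (restrict_space borel A) \<in> sets (restrict_space borel A)"
    by (rule measurable_sets[OF borel_measurable_continuous_on_restrict]) (use assms in auto)
  then show ?thesis
    using assms(2) by (auto simp: sets_restrict_space_iff space_restrict_space Int_commute)
qed

text \<open>The Jacobian of the lift has modulus \<open>c > 0\<close>, so the inverse function
  theorem applies to \<open>F\<close>. Source and target are then shrunk until
  \<open>torus_proj\<close> is injective on both; injectivity, openness and scaling of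
  \<open>F\<close> all descend to \<open>f\<close>.\<close>

lemma torus_local_lift:
  fixes f :: "'n::finite torus \<Rightarrow> 'n torus" and F' :: "real ^ 'n \<Rightarrow> (real ^ 'n) \<Rightarrow>\<^sub>L (real ^ 'n)"
  assumes U: "open U" "x \<in> U" and lift: "lifts_on U F f"
    and der: "\<And>v. v \<in> U \<Longrightarrow> (F has_derivative blinfun_apply (F' v)) (at v)"
    and cont: "continuous_on U F'"
    and det: "\<And>p. \<bar>det (torus_deriv f p)\<bar> = c" and c: "c > 0"
  obtains V where "open V" "torus_proj x \<in> V" "inj_on f V" "continuous_on V f"
    "\<And>W. open W \<Longrightarrow> W \<subseteq> V \<Longrightarrow> open (f ` W)"
    "\<And>B. B \<in> sets borel \<Longrightarrow> B \<subseteq> V \<Longrightarrow> f ` B \<in> sets borel \<Longrightarrow>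
       emeasure torus_lebesgue (f ` B) = ennreal c * emeasure torus_lebesgue B"
proof -
  \<comment> \<open>The derivative of this particular lift is the torus derivative, by uniqueness;
    the assumption on \<open>torus_deriv\<close> thus becomes one about \<open>F\<close> on all of
    \<open>U\<close>.\<close>
  have D: "\<bar>det (matrix (blinfun_apply (F' v)))\<bar> = c" if "v \<in> U" for v
  proof -
    have "blinfun_apply (F' v) = (\<lambda>u. matrix (blinfun_apply (F' v)) *v u)"
      by (rule ext) (simp add: matrix_works linear_conv_bounded_linear blinfun.bounded_linear_right)
    then have "has_torus_derivative f (matrix (blinfun_apply (F' v))) (torus_proj v)"
      unfolding has_torus_derivative_def using U lift der[OF that] that by metis
    then show ?thesis using det by (metis torus_deriv_eq)
  qed
  define A where "A = matrix (blinfun_apply (F' x))"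
  have "invertible A" using D[OF U(2)] c by (auto simp: A_def invertible_det_nz)
  then obtain A' where invA: "A' ** A = mat 1" by (auto simp: invertible_def)
  have inv: "Blinfun ((*v) A') o\<^sub>L F' x = id_blinfun"
  proof (rule blinfun_eqI)
    fix v
    have "blinfun_apply (F' x) v = A *v v"
      by (simp add: A_def matrix_works linear_conv_bounded_linear blinfun.bounded_linear_right)
    then show "blinfun_apply (Blinfun ((*v) A') o\<^sub>L F' x) v = blinfun_apply id_blinfun v"
      by (simp add: bounded_linear_Blinfun_apply matrix_vector_mul_assoc invA)
  qed
  have ball: "open (U \<inter> ball x (1/2))" "x \<in> U \<inter> ball x (1/2)" using U by auto
  have cont': "continuous_on (U \<inter> ball x (1/2)) F'" using cont by (rule continuous_on_subset) auto
  have der': "(F has_derivative blinfun_apply (F' v)) (at v)" if "v \<in> U \<inter> ball x (1/2)" for v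
    using der that by simp
  obtain U' V' g where U': "open U'" "U' \<subseteq> U \<inter> ball x (1/2)" "x \<in> U'" "open V'" "F x \<in> V'"
    and hom: "homeomorphism U' V' F g"
    by (rule inverse_function_theorem[OF ball(1) der' cont' ball(2) inv])
  have F_cont: "continuous_on U' F" and g_cont: "continuous_on V' g"
    and gF: "\<And>u. u \<in> U' \<Longrightarrow> g (F u) = u" and Fg: "\<And>w. w \<in> V' \<Longrightarrow> F (g w) = w"
    and FU: "F ` U' = V'" and gV: "g ` V' = U'"
    using hom by (auto simp: homeomorphism_def)
  \<comment> \<open>Injectivity of \<open>F\<close> alone would still allow two image points to
    differ by a lattice vector; cutting the target down to radius 1/2 excludes this.\<close>
  define W' where "W' = V' \<inter> ball (F x) (1/2)"
  define U2 where "U2 = U' \<inter> F -` W'"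
  have W': "open W'" using U' by (auto simp: W'_def)
  have U2: "open U2" unfolding U2_def using F_cont U' W' by (intro continuous_open_preimage) auto
  have F_inj: "inj_on F U2" by (rule inj_on_inverseI[of _ g]) (auto simp: U2_def gF)
  have p_inj: "inj_on torus_proj U2"
    by (rule inj_on_subset[OF inj_on_torus_proj_ball[of x]]) (use U' in \<open>auto simp: U2_def\<close>)
  have p_inj': "inj_on torus_proj W'"
    by (rule inj_on_subset[OF inj_on_torus_proj_ball[of "F x"]]) (auto simp: W'_def)
  \<comment> \<open>Images under \<open>F\<close> are written as preimages under the continuous
    inverse \<open>g\<close>, which keeps open sets open and Borel sets Borel.\<close>
  have FS: "F ` S = W' \<inter> g -` S" if "S \<subseteq> U2" for S
  proof (intro equalityI subsetI)
    fix w assume "w \<in> F ` S"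
    then show "w \<in> W' \<inter> g -` S" using that gF by (auto simp: U2_def)
  next
    fix w assume "w \<in> W' \<inter> g -` S"
    then show "w \<in> F ` S" using Fg by (auto simp: W'_def image_iff) metis
  qed
  have g_cont': "continuous_on W' g" using g_cont by (rule continuous_on_subset) (auto simp: W'_def)
  have fp: "f ` torus_proj ` S = torus_proj ` F ` S" if "S \<subseteq> U2" for S
  proof -
    have "f (torus_proj v) = torus_proj (F v)" if "v \<in> S" for v
      using lift that \<open>S \<subseteq> U2\<close> U' by (auto simp: lifts_on_def U2_def subset_iff)
    then show ?thesis by (force simp: image_image)
  qed
  define V where "V = torus_proj ` U2"
  have pS: "torus_proj ` (U2 \<inter> torus_proj -` B) = B" if "B \<subseteq> V" for B
    using that by (auto simp: V_def)
  show thesis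
  proof
    show "open V" unfolding V_def by (rule open_torus_proj_image[OF U2])
    show "torus_proj x \<in> V" using U' by (auto simp: V_def U2_def W'_def)
    have fv: "f (torus_proj v) = torus_proj (F v)" if "v \<in> U2" for v
      using fp[of "{v}"] that by auto
    show "inj_on f V"
    proof (rule inj_onI)
      fix p q assume "p \<in> V" "q \<in> V" "f p = f q"
      then obtain u v where uv: "p = torus_proj u" "q = torus_proj v" "u \<in> U2" "v \<in> U2"
        by (auto simp: V_def)
      then have "torus_proj (F u) = torus_proj (F v)" using \<open>f p = f q\<close> fv by metis
      moreover have "F u \<in> W'" "F v \<in> W'" using uv by (auto simp: U2_def)
      ultimately have "F u = F v" using p_inj' by (metis inj_onD)
      then show "p = q" using uv F_inj by (metis inj_onD)
    qed
    show op: "open (f ` W)" if "open W" "W \<subseteq> V" for W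
    proof -
      have "open (U2 \<inter> torus_proj -` W)"
        by (rule continuous_open_preimage[OF continuous_on_torus_proj U2 that(1)])
      then have "open (W' \<inter> g -` (U2 \<inter> torus_proj -` W))"
        by (rule continuous_open_preimage[OF g_cont' W'])
      then have "open (torus_proj ` F ` (U2 \<inter> torus_proj -` W))"
        by (subst FS) (auto intro: open_torus_proj_image)
      then show ?thesis using fp[of "U2 \<inter> torus_proj -` W"] pS[OF that(2)] by simp
    qed
    show "continuous_on V f"
      unfolding continuous_on_open_vimage[OF \<open>open V\<close>]
    proof (intro allI impI)
      fix B :: "'n torus set" assume "open B"
      have "continuous_on U2 (torus_proj \<circ> F)"
        by (intro continuous_on_compose continuous_on_torus_proj)
          (rule continuous_on_subset[OF F_cont], auto simp: U2_def)
      then have "open (U2 \<inter> (torus_proj \<circ> F) -` B)"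
        by (rule continuous_open_preimage) (use U2 \<open>open B\<close> in auto)
      then have "open (torus_proj ` (U2 \<inter> (torus_proj \<circ> F) -` B))" by (rule open_torus_proj_image)
      also have "torus_proj ` (U2 \<inter> (torus_proj \<circ> F) -` B) = f -` B \<inter> V"
        using fv by (auto simp: V_def)
      finally show "open (f -` B \<inter> V)" .
    qed
    fix B assume B: "B \<in> sets borel" "B \<subseteq> V" "f ` B \<in> sets borel"
    define S where "S = U2 \<inter> torus_proj -` B"
    have S: "S \<in> sets borel" unfolding S_def
      by (rule borel_continuous_preimage[OF continuous_on_torus_proj]) (use U2 B in auto)
    have pSB: "torus_proj ` S = B" using pS[OF B(2)] by (simp add: S_def)
    have FSb: "F ` S \<in> sets borel"
    proof (subst FS)
      show "S \<subseteq> U2" by (auto simp: S_def)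
      show "W' \<inter> g -` S \<in> sets borel"
        by (rule borel_continuous_preimage[OF g_cont' _ S]) (use W' in simp)
    qed
    have fB: "torus_proj ` F ` S = f ` B" using fp[of S] pSB by (simp add: S_def)
    have "emeasure torus_lebesgue (f ` B) = emeasure lborel (F ` S)"
      unfolding fB[symmetric]
      by (rule emeasure_torus_lebesgue_proj[OF FSb])
        (use B fB in \<open>auto simp: S_def U2_def intro: inj_on_subset[OF p_inj']\<close>)
    also have "\<dots> = ennreal c * emeasure lborel S"
    proof (rule emeasure_image_const_det[OF S FSb])
      have "emeasure lborel S \<le> emeasure lborel (ball x (1/2))"
        using U' by (intro emeasure_mono) (auto simp: S_def U2_def)
      also have "\<dots> < \<infinity>" by (rule emeasure_lborel_ball_finite)
      finally show "emeasure lborel S < \<infinity>" .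
      show "(F has_derivative blinfun_apply (F' v)) (at v)"
        "\<bar>det (matrix (blinfun_apply (F' v)))\<bar> = c" if "v \<in> S" for v
        using that U' der D by (auto simp: S_def U2_def subset_iff)
      show "inj_on F S" using F_inj by (rule inj_on_subset) (auto simp: S_def)
    qed
    also have "emeasure lborel S = emeasure torus_lebesgue B"
      using emeasure_torus_lebesgue_proj[OF S] pSB B inj_on_subset[OF p_inj, of S]
      by (simp add: S_def)
    finally show "emeasure torus_lebesgue (f ` B) = ennreal c * emeasure torus_lebesgue B" .
  qed
qed

section \<open>Fibres of local homeomorphisms\<close>

text \<open>Openness is demanded of the images of all open subsets of \<open>V\<close>, so that
  neighbourhoods can be shrunk at will, for instance to separate the points of a fibre.\<close>

definition local_homeo :: "('a::metric_space \<Rightarrow> 'b::metric_space) \<Rightarrow> bool" where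
  "local_homeo f \<longleftrightarrow> (\<forall>p. \<exists>V. open V \<and> p \<in> V \<and> inj_on f V \<and> continuous_on V f \<and>
     (\<forall>W. open W \<longrightarrow> W \<subseteq> V \<longrightarrow> open (f ` W)))"

lemma local_homeo_continuous:
  assumes "local_homeo f" shows "continuous_on S f"
proof -
  have "isCont f p" for p
    using assms unfolding local_homeo_def by (metis continuous_on_eq_continuous_at)
  then show ?thesis by (simp add: continuous_at_imp_continuous_on)
qed

text \<open>Finitely many sets of injectivity cover the compact space, and each contains at most one
  point of the fibre.\<close>

lemma finite_fiber_local_homeo:
  assumes "compact (UNIV :: 'a::metric_space set)" "local_homeo (f :: 'a \<Rightarrow> 'b::metric_space)"
  shows "finite (f -` {x})"
proof -
  obtain V where V: "\<And>p. open (V p) \<and> p \<in> V p \<and> inj_on f (V p)"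
    using assms(2) unfolding local_homeo_def by metis
  obtain D where D: "finite D" "UNIV \<subseteq> (\<Union>p\<in>D. V p)"
    by (rule compactE_image[OF assms(1), of UNIV V]) (use V in auto)
  have "finite (f -` {x} \<inter> V p)" for p
  proof -
    have "f ` (f -` {x} \<inter> V p) \<subseteq> {x}" by auto
    moreover have "inj_on f (f -` {x} \<inter> V p)" using V by (meson inj_on_subset inf_le2)
    ultimately show ?thesis by (meson finite.emptyI finite_insert finite_imageD finite_subset)
  qed
  then have "finite (\<Union>p\<in>D. f -` {x} \<inter> V p)" using D by blast
  then show ?thesis by (rule finite_subset[rotated]) (use D in auto)
qed

lemma finite_separated:
  fixes P :: "'a::metric_space set"
  assumes "finite P"
  obtains d where "d > 0" "\<And>y z. y \<in> P \<Longrightarrow> z \<in> P \<Longrightarrow> y \<noteq> z \<Longrightarrow> d \<le> dist y z"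
proof -
  \<comment> \<open>The extra element 1 keeps the minimum defined when \<open>P\<close> has no two
    distinct points.\<close>
  define D where "D = insert 1 ((\<lambda>(y, z). dist y z) ` {(y, z). y \<in> P \<and> z \<in> P \<and> y \<noteq> z})"
  have "finite {(y, z). y \<in> P \<and> z \<in> P \<and> y \<noteq> z}"
    by (rule finite_subset[of _ "P \<times> P"]) (use assms in auto)
  then have D: "finite D" "D \<noteq> {}" by (auto simp: D_def)
  have "Min D > 0" using D by (subst Min_gr_iff) (auto simp: D_def)
  moreover have "Min D \<le> dist y z" if "y \<in> P" "z \<in> P" "y \<noteq> z" for y z
    using D that by (intro Min_le) (auto simp: D_def)
  ultimately show ?thesis using that by blast
qed

text \<open>The points of the fibre have disjoint neighbourhoods on which \<open>f\<close> is
  injective with open image. A fibre close to that of \<open>x\<close> has exactly one point in each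
  of them, and none elsewhere because the rest of the space is compact and its closed image misses
  \<open>x\<close>.\<close>

lemma card_fiber_locally_constant:
  assumes cpt: "compact (UNIV :: 'a::metric_space set)" and lh: "local_homeo (f :: 'a \<Rightarrow> 'b::metric_space)"
  shows "\<exists>W. open W \<and> x \<in> W \<and> (\<forall>x'\<in>W. card (f -` {x'}) = card (f -` {x}))"
proof -
  define P where "P = f -` {x}"
  have P: "finite P" unfolding P_def by (rule finite_fiber_local_homeo[OF assms])
  obtain d where d: "d > 0" "\<And>y z. y \<in> P \<Longrightarrow> z \<in> P \<Longrightarrow> y \<noteq> z \<Longrightarrow> d \<le> dist y z"
    using finite_separated[OF P] by blast
  obtain V where V: "\<And>p. open (V p) \<and> p \<in> V p \<and> inj_on f (V p) \<and>
     (\<forall>W. open W \<longrightarrow> W \<subseteq> V p \<longrightarrow> open (f ` W))"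
    using lh unfolding local_homeo_def by metis
  define V' where "V' p = V p \<inter> ball p (d/2)" for p
  have V': "open (V' p)" "p \<in> V' p" "inj_on f (V' p)" "open (f ` V' p)" for p
  proof -
    show "open (V' p)" "p \<in> V' p" "inj_on f (V' p)"
      using V[of p] d(1) by (auto simp: V'_def intro: inj_on_subset)
    then show "open (f ` V' p)" using V[of p] by (auto simp: V'_def)
  qed
  have disj: "y = z" if "y \<in> P" "z \<in> P" "u \<in> V' y" "u \<in> V' z" for y z u
  proof (rule ccontr)
    assume "y \<noteq> z"
    then have "d \<le> dist y z" using d that by blast
    also have "\<dots> \<le> dist y u + dist z u" by (rule dist_triangle2)
    also have "\<dots> < d" using that by (auto simp: V'_def)
    finally show False by simp
  qed
  \<comment> \<open>Membership in the intersection provides a preimage in each neighbourhood; the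
    removed set consists of the points with a preimage outside all of them.\<close>
  define W where "W = (\<Inter>y\<in>P. f ` V' y) - f ` (UNIV - (\<Union>y\<in>P. V' y))"
  have "compact (UNIV - (\<Union>y\<in>P. V' y))"
    by (rule compact_diff[OF cpt]) (use V' in auto)
  then have "closed (f ` (UNIV - (\<Union>y\<in>P. V' y)))"
    by (intro compact_imp_closed compact_continuous_image local_homeo_continuous[OF lh])
  then have "open W" unfolding W_def using V' P by (intro open_Diff open_INT) auto
  moreover have "x \<in> W" using V'(2) by (auto simp: W_def P_def)
  moreover have "card (f -` {x'}) = card P" if x': "x' \<in> W" for x'
  proof -
    have "\<forall>y\<in>P. \<exists>u. u \<in> V' y \<and> f u = x'" using x' by (auto simp: W_def)
    then obtain h where h: "\<And>y. y \<in> P \<Longrightarrow> h y \<in> V' y \<and> f (h y) = x'" by metis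
    have "bij_betw h P (f -` {x'})"
    proof (rule bij_betw_imageI)
      show "inj_on h P" using disj h by (metis inj_onI)
      have "u \<in> h ` P" if "f u = x'" for u
      proof -
        have "u \<in> (\<Union>y\<in>P. V' y)"
        proof (rule ccontr)
          assume "u \<notin> (\<Union>y\<in>P. V' y)"
          then have "f u \<in> f ` (UNIV - (\<Union>y\<in>P. V' y))" by (intro imageI DiffI UNIV_I)
          then show False using x' unfolding that W_def by (metis DiffD2)
        qed
        then obtain y where y: "y \<in> P" "u \<in> V' y" by (rule UN_E)
        then have "u = h y" using h[of y] V'(3)[of y] that by (metis inj_onD)
        then show ?thesis using y by blast
      qed
      then show "h ` P = f -` {x'}" using h by auto
    qed
    then show ?thesis by (simp add: bij_betw_same_card)
  qed
  ultimately show ?thesis unfolding P_def by blast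
qed

lemma card_fiber_constant:
  assumes "compact (UNIV :: 'a::metric_space set)" "local_homeo (f :: 'a \<Rightarrow> 'b::metric_space)"
    and conn: "connected (UNIV :: 'b set)"
  shows "card (f -` {x}) = card (f -` {y})"
proof (rule connected_local_const[OF conn, of x y "\<lambda>x. card (f -` {x})"])
  show "\<forall>a\<in>UNIV. \<forall>\<^sub>F b in at a. card (f -` {a}) = card (f -` {b})"
  proof
    fix a
    obtain W where "open W" "a \<in> W" "\<forall>b\<in>W. card (f -` {b}) = card (f -` {a})"
      using card_fiber_locally_constant[OF assms(1,2), of a] by blast
    then show "\<forall>\<^sub>F b in at a. card (f -` {a}) = card (f -` {b})"
      unfolding eventually_at_topological by metis
  qed
qed auto

text \<open>Each neighbourhood contains a closed ball whose interior open ball already takes part in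
  the cover. The property \<open>Q\<close> is left open, since injectivity alone is wanted in one
  place and injectivity with scaling of a measure in another.\<close>

lemma finite_compact_cover:
  fixes Q :: "'a::metric_space set \<Rightarrow> bool"
  assumes cpt: "compact (UNIV :: 'a set)"
    and Q: "\<And>p. \<exists>V. open V \<and> p \<in> V \<and> Q V"
  obtains K :: "nat \<Rightarrow> 'a set" and m
    where "\<And>i. i < m \<Longrightarrow> compact (K i)" "\<And>i. i < m \<Longrightarrow> \<exists>V. K i \<subseteq> V \<and> Q V" "(\<Union>i<m. K i) = UNIV"
proof -
  have "\<forall>p. \<exists>e>0. \<exists>V. cball p e \<subseteq> V \<and> Q V"
    using Q by (metis open_contains_cball)
  then obtain e where e: "\<And>p. e p > 0" "\<And>p. \<exists>V. cball p (e p) \<subseteq> V \<and> Q V" by metis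
  obtain D where D: "finite D" "UNIV \<subseteq> (\<Union>p\<in>D. ball p (e p))"
    by (rule compactE_image[OF cpt, of UNIV "\<lambda>p. ball p (e p)"])
      (use e(1) in \<open>auto intro: UN_I[OF UNIV_I]\<close>)
  obtain xs where xs: "set xs = D" using finite_list[OF D(1)] by blast
  define K where "K i = cball (xs ! i) (e (xs ! i))" for i
  show thesis
  proof
    show "compact (K i)" for i
      using compact_Int_closed[OF cpt closed_cball] by (simp add: K_def)
    show "\<exists>V. K i \<subseteq> V \<and> Q V" for i unfolding K_def by (rule e(2))
    show "(\<Union>i<length xs. K i) = UNIV"
    proof -
      have "z \<in> (\<Union>i<length xs. K i)" for z
      proof -
        obtain p where "p \<in> D" "z \<in> ball p (e p)" using D by blast
        moreover then obtain i where "i < length xs" "xs ! i = p" using xs by (metis in_set_conv_nth)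
        ultimately show ?thesis by (force simp: K_def)
      qed
      then show ?thesis by blast
    qed
  qed
qed

text \<open>On a compact set the inverse of a continuous injection is continuous, and the image of
  \<open>B\<close> is a preimage under this inverse.\<close>

lemma borel_image_compact_inj:
  fixes f :: "'a::t2_space \<Rightarrow> 'b::t2_space"
  assumes K: "compact K" and f: "continuous_on K f" "inj_on f K" and B: "B \<in> sets borel" "B \<subseteq> K"
  shows "f ` B \<in> sets borel"
proof -
  have cl: "f ` K \<in> sets borel"
    by (intro borel_compact compact_continuous_image K f)
  have "continuous_on (f ` K) (the_inv_into K f)"
    by (rule continuous_on_inv[OF f(1) K]) (use f in \<open>auto simp: the_inv_into_f_f\<close>)
  then have "the_inv_into K f -` B \<inter> space (restrict_space borel (f ` K)) \<in> sets (restrict_space borel (f ` K))"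
    by (intro measurable_sets[OF borel_measurable_continuous_on_restrict] B)
  then have "f ` K \<inter> the_inv_into K f -` B \<in> sets borel"
    using cl by (auto simp: sets_restrict_space_iff space_restrict_space Int_commute)
  also have "f ` K \<inter> the_inv_into K f -` B = f ` B"
    using B(2) f(2) by (auto simp: the_inv_into_f_f subset_iff)
  finally show ?thesis .
qed

section \<open>Disintegration and folding entropy\<close>

text \<open>The compact cover is made disjoint by removing earlier sets. Each Borel piece
  \<open>U i\<close> keeps its compact hull \<open>K i\<close>, because the inverse branch is
  defined and continuous on the image of the hull.\<close>

lemma finite_borel_partition:
  fixes Q :: "'a::metric_space set \<Rightarrow> bool"
  assumes cpt: "compact (UNIV :: 'a set)"
    and Q: "\<And>p. \<exists>V. open V \<and> p \<in> V \<and> Q V"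
  obtains K U :: "nat \<Rightarrow> 'a set" and m
    where "\<And>i. i < m \<Longrightarrow> compact (K i)" "\<And>i. i < m \<Longrightarrow> \<exists>V. K i \<subseteq> V \<and> Q V"
      "\<And>i. i < m \<Longrightarrow> U i \<subseteq> K i" "\<And>i. i < m \<Longrightarrow> U i \<in> sets borel"
      "disjoint_family_on U {..<m}" "(\<Union>i<m. U i) = UNIV"
proof -
  obtain K :: "nat \<Rightarrow> 'a set" and m where K: "\<And>i. i < m \<Longrightarrow> compact (K i)"
    and KV: "\<And>i. i < m \<Longrightarrow> \<exists>V. K i \<subseteq> V \<and> Q V" and cover: "(\<Union>i<m. K i) = UNIV"
    by (rule finite_compact_cover[of Q, OF cpt Q]) (rule that)
  define U where "U i = K i - (\<Union>j<i. K j)" for i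
  show thesis
  proof (rule that[OF K KV])
    show "U i \<subseteq> K i" for i by (auto simp: U_def)
    show "U i \<in> sets borel" if "i < m" for i
      unfolding U_def using K that by (intro sets.Diff sets.finite_UN borel_compact) auto
    show "disjoint_family_on U {..<m}"
    proof (unfold disjoint_family_on_def U_def, intro ballI impI)
      fix i j :: nat assume "i \<noteq> j"
      then consider "i < j" | "j < i" by linarith
      then show "(K i - (\<Union>j<i. K j)) \<inter> (K j - (\<Union>i<j. K i)) = {}" by cases auto
    qed
    have "z \<in> (\<Union>i<m. U i)" for z
    proof -
      obtain j where j: "j < m" "z \<in> K j" using cover by (metis UNIV_I UN_E lessThan_iff)
      define i where "i = (LEAST i. z \<in> K i)"
      have "z \<in> K i" unfolding i_def by (rule LeastI[of "\<lambda>i. z \<in> K i"]) (rule j)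
      moreover have "i \<le> j" unfolding i_def by (rule Least_le) (rule j)
      moreover have "z \<notin> K l" if "l < i" for l using that unfolding i_def by (rule not_less_Least)
      ultimately show ?thesis using j by (auto simp: U_def)
    qed
    then show "(\<Union>i<m. U i) = UNIV" by blast
  qed
qed

lemma emeasure_sum_partition:
  assumes "\<And>i. i < m \<Longrightarrow> U i \<in> sets M" "disjoint_family_on U {..<m::nat}"
    and "(\<Union>i<m. U i) = space M" "B \<in> sets M"
  shows "emeasure M B = (\<Sum>i<m. emeasure M (U i \<inter> B))"
proof -
  have "emeasure M (\<Union>i<m. U i \<inter> B) = (\<Sum>i<m. emeasure M (U i \<inter> B))"
    using assms by (intro sum_emeasure[symmetric]) (auto simp: disjoint_family_on_def)
  moreover have "(\<Union>i<m. U i \<inter> B) = B" using assms(3) sets.sets_into_space[OF assms(4)] by blast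
  ultimately show ?thesis by simp
qed

text \<open>An atomic measure, obtained by pushing forward a weighted counting measure on the
  indices, so that atoms at coinciding positions add up automatically.\<close>

definition point_mixture :: "'a measure \<Rightarrow> nat \<Rightarrow> (nat \<Rightarrow> ennreal) \<Rightarrow> (nat \<Rightarrow> 'a) \<Rightarrow> 'a measure" where
  "point_mixture M m w s = distr (density (count_space {..<m}) w) M s"

lemma sets_point_mixture [simp]: "sets (point_mixture M m w s) = sets M"
  by (simp add: point_mixture_def)

lemma emeasure_point_mixture:
  assumes "\<And>i. i < m \<Longrightarrow> s i \<in> space M" "B \<in> sets M"
  shows "emeasure (point_mixture M m w s) B = (\<Sum>i<m. w i * indicator B (s i))"
proof -
  have "emeasure (point_mixture M m w s) B =
      emeasure (density (count_space {..<m}) w) (s -` B \<inter> {..<m})"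
    unfolding point_mixture_def using assms by (subst emeasure_distr) auto
  also have "\<dots> = (\<integral>\<^sup>+i. w i * indicator (s -` B \<inter> {..<m}) i \<partial>count_space {..<m})"
    by (subst emeasure_density) auto
  also have "\<dots> = (\<Sum>i<m. w i * indicator (s -` B \<inter> {..<m}) i)"
    by (subst nn_integral_count_space_finite) auto
  also have "\<dots> = (\<Sum>i<m. w i * indicator B (s i))"
    by (rule sum.cong) (auto simp: indicator_def)
  finally show ?thesis .
qed

text \<open>The folding entropy is defined through \<open>SOME\<close> disintegration, hence says nothing unless one
  exists. The mass given to the preimage of \<open>x\<close> in the \<open>i\<close>-th piece of injectivity is the
  Radon-Nikodym density at \<open>x\<close> of the image of \<open>M\<close> restricted to that piece; \<open>M\<close> dominates this
  image by invariance.\<close>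

lemma fiber_disintegration_exists:
  fixes f :: "'a::metric_space \<Rightarrow> 'a"
  assumes cpt: "compact (UNIV :: 'a set)" and lh: "local_homeo f" and inv: "invariant_prob f M"
  shows "\<exists>\<kappa>. fiber_disintegration f M \<kappa>"
proof -
  interpret prob_space M using inv by (simp add: invariant_prob_def)
  have sM [measurable_cong, simp]: "sets M = sets borel" and fM: "f \<in> M \<rightarrow>\<^sub>M M"
    and dM: "distr M M f = M" using inv by (auto simp: invariant_prob_def)
  have spM [simp]: "space M = UNIV" using sets_eq_imp_space_eq[OF sM] by simp
  note [measurable] = fM
  obtain V where V: "\<And>p. open (V p) \<and> p \<in> V p \<and> inj_on f (V p)"
    using lh unfolding local_homeo_def by metis
  have V': "\<exists>V. open V \<and> p \<in> V \<and> inj_on f V" for p using V by metis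
  obtain K U :: "nat \<Rightarrow> 'a set" and m where K: "\<And>i. i < m \<Longrightarrow> compact (K i)"
    and KV: "\<And>i. i < m \<Longrightarrow> \<exists>V. K i \<subseteq> V \<and> inj_on f V"
    and UK: "\<And>i. i < m \<Longrightarrow> U i \<subseteq> K i" and Ub0: "\<And>i. i < m \<Longrightarrow> U i \<in> sets borel"
    and Udisj: "disjoint_family_on U {..<m}" and Uun: "(\<Union>i<m. U i) = UNIV"
    by (rule finite_borel_partition[of "inj_on f", OF cpt V']) (rule that)
  have Kinj: "inj_on f (K i)" if "i < m" for i using KV[OF that] by (meson inj_on_subset)
  have m: "m > 0" using Uun by (cases m) auto
  have Kb: "K i \<in> sets M" "f ` K i \<in> sets M" if "i < m" for i
    using K[OF that] local_homeo_continuous[OF lh]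
    by (auto intro!: borel_compact compact_continuous_image)
  have Ub [measurable]: "U i \<in> sets M" if "i < m" for i using Ub0[OF that] by simp
  have split: "emeasure M B = (\<Sum>i<m. emeasure M (U i \<inter> B))" if "B \<in> sets M" for B
    by (rule emeasure_sum_partition) (use that Ub Udisj Uun in auto)
  define \<nu> where "\<nu> i = distr (density M (indicator (U i))) M f" for i
  have \<nu>: "emeasure (\<nu> i) B = emeasure M (U i \<inter> f -` B)" if "i < m" "B \<in> sets M" for i B
    unfolding \<nu>_def using that Ub[OF that(1)] measurable_sets[OF fM that(2)]
    by (subst emeasure_distr) (auto simp: emeasure_restricted)
  have pre: "emeasure M (f -` B) = emeasure M B" if "B \<in> sets M" for B
    using that by (subst (2) dM[symmetric]) (simp add: emeasure_distr)
  have "\<exists>g\<in>borel_measurable M. density M g = \<nu> i" if "i < m" for i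
  proof (rule Radon_Nikodym)
    show "absolutely_continuous M (\<nu> i)"
      unfolding absolutely_continuous_def
    proof
      fix B assume B: "B \<in> null_sets M"
      then have b: "B \<in> sets M" by auto
      have "emeasure M (U i \<inter> f -` B) \<le> emeasure M (f -` B)"
        using measurable_sets[OF fM b] by (intro emeasure_mono) auto
      then have "emeasure (\<nu> i) B = 0" using \<nu>[OF that b] pre[OF b] B by auto
      then show "B \<in> null_sets (\<nu> i)" using b by (auto simp: \<nu>_def)
    qed
    show "sets (\<nu> i) = sets M" by (simp add: \<nu>_def)
  qed
  then obtain g where g0: "\<And>i. i < m \<Longrightarrow> g i \<in> borel_measurable M"
    and g1: "\<And>i. i < m \<Longrightarrow> density M (g i) = \<nu> i" by metis
  have g: "(\<integral>\<^sup>+x. g i x * indicator B x \<partial>M) = emeasure M (U i \<inter> f -` B)" if "i < m" "B \<in> sets M" for i B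
    using g0[OF that(1)] \<nu>[OF that] that(2) by (simp add: g1[OF that(1), symmetric] emeasure_density)
  \<comment> \<open>The images of the pieces add up to the image of \<open>M\<close>, which is
    \<open>M\<close> itself and has density 1.\<close>
  have sum1: "AE x in M. (\<Sum>i<m. g i x) = 1"
  proof (rule density_unique2)
    show "(\<lambda>x. \<Sum>i<m. g i x) \<in> borel_measurable M" using g0 by simp
    fix B assume B: "B \<in> sets M"
    have "(\<integral>\<^sup>+x. (\<Sum>i<m. g i x) * indicator B x \<partial>M) = (\<Sum>i<m. \<integral>\<^sup>+x. g i x * indicator B x \<partial>M)"
      unfolding sum_distrib_right using g0 B by (intro nn_integral_sum) auto
    also have "\<dots> = (\<Sum>i<m. emeasure M (U i \<inter> f -` B))" using g B by simp
    also have "\<dots> = emeasure M (f -` B)"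
      using split[of "f -` B"] measurable_sets[OF fM B] by simp
    also have "\<dots> = (\<integral>\<^sup>+x. 1 * indicator B x \<partial>M)" using pre[OF B] B by simp
    finally show "(\<integral>\<^sup>+x\<in>B. (\<Sum>i<m. g i x) \<partial>M) = (\<integral>\<^sup>+x\<in>B. 1 \<partial>M)" .
  qed simp
  \<comment> \<open>The image of the \<open>i\<close>-th piece is carried by the image of
    \<open>K i\<close>; almost surely, a branch gets mass only where it exists.\<close>
  have off: "AE x in M. x \<notin> f ` K i \<longrightarrow> g i x = 0" if i: "i < m" for i
  proof -
    have "(\<integral>\<^sup>+x. g i x * indicator (- f ` K i) x \<partial>M) = 0"
    proof -
      have "- f ` K i \<in> sets M" using Kb(2)[OF i] by (metis sets.compl_sets spM Compl_eq_Diff_UNIV)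
      moreover have "U i \<inter> f -` (- f ` K i) = {}" using UK[OF i] by auto
      ultimately show ?thesis using g[OF i, of "- f ` K i"] by simp
    qed
    then have "AE x in M. g i x * indicator (- f ` K i) x = 0"
      using g0[OF i] Kb(2)[OF i] by (subst (asm) nn_integral_0_iff_AE) auto
    then show ?thesis by eventually_elim (auto simp: indicator_def split: if_splits)
  qed
  define G where "G = {x\<in>space M. (\<Sum>i<m. g i x) = 1}"
  have [measurable]: "(\<lambda>x. \<Sum>i<m. g i x) \<in> borel_measurable M" using g0 by simp
  have G [measurable]: "G \<in> sets M" unfolding G_def by measurable
  \<comment> \<open>The densities sum to 1 only on \<open>G\<close>. On its null complement all mass
    goes to branch 0, since the kernel has to consist of probabilities at every point.\<close>
  define w where "w i x = (if x \<in> G then g i x else if i = 0 then 1 else 0)" for i x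
  have w [measurable]: "w i \<in> borel_measurable M" if "i < m" for i
    unfolding w_def using g0[OF that] G by (intro measurable_If) auto
  have w1: "(\<Sum>i<m. w i x) = 1" for x
    using m by (cases "x \<in> G") (auto simp: w_def G_def)
  \<comment> \<open>The inverse branch into \<open>K i\<close>. The constant value outside the image
    keeps it Borel and almost surely carries no weight.\<close>
  define s where "s i x = (if x \<in> f ` K i then the_inv_into (K i) f x else undefined)" for i x
  have sf: "s i (f y) = y" if "i < m" "y \<in> K i" for i y
    using that Kinj by (simp add: s_def the_inv_into_f_f)
  have fs: "f (s i x) = x" if "i < m" "x \<in> f ` K i" for i x
    using that Kinj by (simp add: s_def f_the_inv_into_f)
  have s [measurable]: "s i \<in> M \<rightarrow>\<^sub>M M" if i: "i < m" for i
  proof -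
    have "continuous_on (f ` K i) (the_inv_into (K i) f)"
      by (rule continuous_on_inv[OF local_homeo_continuous[OF lh] K[OF i]])
        (use Kinj[OF i] in \<open>auto simp: the_inv_into_f_f\<close>)
    then have "the_inv_into (K i) f \<in> borel_measurable (restrict_space borel (f ` K i))"
      by (rule borel_measurable_continuous_on_restrict)
    then have "s i \<in> borel \<rightarrow>\<^sub>M borel"
      unfolding s_def by (subst (asm) measurable_restrict_space_iff[of _ _ undefined]) (use Kb(2)[OF i] in auto)
    then show ?thesis by (simp add: measurable_cong_sets[OF sM sM])
  qed
  define \<kappa> where "\<kappa> x = point_mixture M m (\<lambda>i. w i x) (\<lambda>i. s i x)" for x
  have \<kappa>: "emeasure (\<kappa> x) B = (\<Sum>i<m. w i x * indicator B (s i x))" if "B \<in> sets M" for x B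
    unfolding \<kappa>_def using that by (intro emeasure_point_mixture) auto
  have term_meas: "(\<lambda>x. w i x * indicator B (s i x)) \<in> borel_measurable M"
    if i: "i < m" and B [measurable]: "B \<in> sets M" for i B
  proof -
    note [measurable] = w[OF i] s[OF i]
    show ?thesis by measurable
  qed
  have \<kappa>_prob: "prob_space (\<kappa> x)" for x
  proof (rule prob_spaceI)
    have "space (\<kappa> x) = UNIV" by (simp add: \<kappa>_def point_mixture_def)
    then show "emeasure (\<kappa> x) (space (\<kappa> x)) = 1" using w1 by (simp add: \<kappa>)
  qed
  have "fiber_disintegration f M \<kappa>"
    unfolding fiber_disintegration_def
  proof (intro conjI ballI)
    show "\<kappa> \<in> M \<rightarrow>\<^sub>M prob_algebra M"
    proof (rule measurable_prob_algebraI[OF \<kappa>_prob], rule measurable_subprob_algebra)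
      show "subprob_space (\<kappa> a)" for a using \<kappa>_prob by (rule prob_space_imp_subprob_space)
      show "sets (\<kappa> a) = sets M" for a by (simp add: \<kappa>_def)
      show "(\<lambda>a. emeasure (\<kappa> a) A) \<in> borel_measurable M" if A [measurable]: "A \<in> sets M" for A
        unfolding \<kappa>[OF A] using term_meas[OF _ A] by (intro borel_measurable_sum) auto
    qed
    have "AE x in M. \<forall>i\<in>{..<m}. x \<notin> f ` K i \<longrightarrow> g i x = 0"
      using off by (intro AE_finite_allI) auto
    then show "AE x in M. emeasure (\<kappa> x) (f -` {x} \<inter> space M) = 1"
      using sum1
    proof eventually_elim
      case (elim x)
      have x: "x \<in> G" using elim by (simp add: G_def)
      have "closed (f -` {x})"
        using continuous_closed_vimage[of "{x}" f] local_homeo_continuous[OF lh, of UNIV]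
        by (simp add: continuous_on_eq_continuous_at)
      then have "f -` {x} \<in> sets M" by simp
      then have "emeasure (\<kappa> x) (f -` {x}) = (\<Sum>i<m. w i x * indicator (f -` {x}) (s i x))" by (rule \<kappa>)
      also have "\<dots> = (\<Sum>i<m. w i x)"
      proof (rule sum.cong)
        fix i assume "i \<in> {..<m}"
        then show "w i x * indicator (f -` {x}) (s i x) = w i x"
          using elim x fs[of i x] by (cases "x \<in> f ` K i") (auto simp: w_def)
      qed simp
      finally show ?case using w1 by simp
    qed
    fix B assume B [measurable]: "B \<in> sets M"
    have "(\<integral>\<^sup>+x. emeasure (\<kappa> x) B \<partial>M) = (\<Sum>i<m. \<integral>\<^sup>+x. w i x * indicator B (s i x) \<partial>M)"
      unfolding \<kappa>[OF B] using term_meas[OF _ B] by (intro nn_integral_sum) auto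
    also have "\<dots> = (\<Sum>i<m. emeasure M (U i \<inter> B))"
    proof (rule sum.cong)
      fix i assume "i \<in> {..<m}"
      then have i: "i < m" by simp
      have sB: "s i -` B \<in> sets M" using measurable_sets[OF s[OF i] B] by simp
      have "AE x in M. w i x * indicator B (s i x) = g i x * indicator (s i -` B) x"
        using sum1 by eventually_elim (auto simp: w_def G_def indicator_def)
      then have "(\<integral>\<^sup>+x. w i x * indicator B (s i x) \<partial>M) = (\<integral>\<^sup>+x. g i x * indicator (s i -` B) x \<partial>M)"
        by (rule nn_integral_cong_AE)
      also have "\<dots> = emeasure M (U i \<inter> f -` (s i -` B))" by (rule g[OF i sB])
      \<comment> \<open>The branch \<open>s i\<close> undoes \<open>f\<close> on \<open>K i\<close>;
        integrating the density over the points whose \<open>i\<close>-th preimage lies in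
        \<open>B\<close> therefore recovers the mass of \<open>B\<close> in the \<open>i\<close>-th
        piece.\<close>
      also have "U i \<inter> f -` (s i -` B) = U i \<inter> B" using sf[OF i] UK[OF i] by auto
      finally show "(\<integral>\<^sup>+x. w i x * indicator B (s i x) \<partial>M) = emeasure M (U i \<inter> B)" .
    qed simp
    also have "\<dots> = emeasure M B" using split[OF B] by simp
    finally show "emeasure M B = (\<integral>\<^sup>+x. emeasure (\<kappa> x) B \<partial>M)" by simp
  qed
  then show ?thesis by blast
qed

text \<open>Comparison with the uniform distribution: \<open>ln t \<le> t - 1\<close> at
  \<open>t = 1 / (N * p y)\<close>, multiplied by \<open>p y\<close>. The corrections
  \<open>1 / N - p y\<close> sum to 0.\<close>

lemma entropy_le_ln_card:
  fixes p :: "'a \<Rightarrow> real"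
  assumes "finite P" "P \<noteq> {}" "\<And>y. y \<in> P \<Longrightarrow> 0 \<le> p y" "sum p P = 1"
  shows "(\<Sum>y\<in>P. - (p y * ln (p y))) \<le> ln (card P)"
proof -
  define N where "N = real (card P)"
  have N: "N > 0" using assms by (simp add: N_def card_gt_0_iff)
  have "- (p y * ln (p y)) \<le> p y * ln N + (1 / N - p y)" if "y \<in> P" for y
  proof (cases "p y = 0")
    case False
    then have py: "p y > 0" using assms that by (metis order_le_less)
    have "ln (1 / (N * p y)) \<le> 1 / (N * p y) - 1" using N py by (intro ln_le_minus_one) simp
    then have "p y * ln (1 / (N * p y)) \<le> p y * (1 / (N * p y) - 1)" using py by simp
    moreover have "p y * (1 / (N * p y) - 1) = 1 / N - p y" using py by (simp add: field_simps)
    moreover have "p y * ln (1 / (N * p y)) = - (p y * ln (p y)) - p y * ln N"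
      using N py by (simp add: ln_div ln_mult algebra_simps)
    ultimately show ?thesis by simp
  qed (use N in simp)
  then have "(\<Sum>y\<in>P. - (p y * ln (p y))) \<le> (\<Sum>y\<in>P. p y * ln N + (1 / N - p y))" by (rule sum_mono)
  also have "\<dots> = sum p P * ln N + (card P * (1 / N) - sum p P)"
    by (simp add: sum.distrib sum_subtractf sum_distrib_right)
  also have "\<dots> = ln N" using N assms by (simp add: N_def)
  finally show ?thesis by (simp add: N_def)
qed

lemma fiber_entropy_finite:
  assumes P: "finite (f -` {x} \<inter> space M)" and "prob_space (fiber_measure f M x)"
  shows "fiber_entropy f M x = ennreal (\<Sum>y\<in>f -` {x} \<inter> space M.
     - (measure (fiber_measure f M x) {y} * ln (measure (fiber_measure f M x) {y})))"
proof -
  have "0 \<le> - (measure (fiber_measure f M x) {y} * ln (measure (fiber_measure f M x) {y}))" for y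
  proof -
    have "measure (fiber_measure f M x) {y} \<le> 1" using assms(2) by (rule prob_space.prob_le_1)
    moreover have "0 \<le> measure (fiber_measure f M x) {y}" by simp
    ultimately show ?thesis
      by (metis ln_le_zero_iff mult_nonneg_nonpos neg_0_le_iff_le order_le_less mult_zero_left order_refl)
  qed
  then show ?thesis unfolding fiber_entropy_def using P by (simp add: sum_ennreal)
qed

text \<open>Existence of a disintegration makes the chosen \<open>fiber_measure\<close> a genuine
  one, so almost every fibre carries a probability on \<open>N\<close> points; the pointwise bound
  is then integrated.\<close>

lemma folding_entropy_le:
  fixes f :: "'a::metric_space \<Rightarrow> 'a"
  assumes cpt: "compact (UNIV :: 'a set)" and lh: "local_homeo f" and inv: "invariant_prob f M"
    and card: "\<And>x. card (f -` {x}) = N" and N: "N > 0"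
  shows "folding_entropy f M \<le> ennreal (ln N)"
proof -
  interpret prob_space M using inv by (simp add: invariant_prob_def)
  have sM: "sets M = sets borel" using inv by (auto simp: invariant_prob_def)
  have spM [simp]: "space M = UNIV" using sets_eq_imp_space_eq[OF sM] by simp
  let ?\<kappa> = "fiber_measure f M"
  have dis: "fiber_disintegration f M ?\<kappa>"
    unfolding fiber_measure_def using fiber_disintegration_exists[OF cpt lh inv] by (rule someI_ex)
  have \<kappa>p: "prob_space (?\<kappa> x)" "sets (?\<kappa> x) = sets borel" for x
  proof -
    have "?\<kappa> x \<in> space (prob_algebra M)"
      using dis measurable_space[of ?\<kappa> M "prob_algebra M" x] by (simp add: fiber_disintegration_def)
    then show "prob_space (?\<kappa> x)" "sets (?\<kappa> x) = sets borel" by (auto simp: space_prob_algebra sM)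
  qed
  have "AE x in M. fiber_entropy f M x \<le> ennreal (ln N)"
  proof -
    have "AE x in M. emeasure (?\<kappa> x) (f -` {x} \<inter> space M) = 1"
      using dis by (simp add: fiber_disintegration_def)
    then show ?thesis
    proof eventually_elim
      case (elim x)
      interpret \<kappa>: prob_space "?\<kappa> x" by (rule \<kappa>p)
      have fin: "finite (f -` {x})" by (rule finite_fiber_local_homeo[OF cpt lh])
      have "(\<Sum>y\<in>f -` {x}. measure (?\<kappa> x) {y}) = measure (?\<kappa> x) (f -` {x})"
        using fin by (intro \<kappa>.finite_measure_eq_sum_singleton[symmetric]) (auto simp: \<kappa>p)
      also have "\<dots> = 1" using elim by (simp add: measure_def)
      finally have "(\<Sum>y\<in>f -` {x}. - (measure (?\<kappa> x) {y} * ln (measure (?\<kappa> x) {y}))) \<le> ln N"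
        using entropy_le_ln_card[OF fin, of "\<lambda>y. measure (?\<kappa> x) {y}"] card[of x] N by fastforce
      then show ?case
        using fiber_entropy_finite[of f x M] fin \<kappa>p by (simp add: ennreal_leI)
    qed
  qed
  then have "folding_entropy f M \<le> (\<integral>\<^sup>+x. ennreal (ln N) \<partial>M)"
    unfolding folding_entropy_def by (rule nn_integral_mono_AE)
  also have "\<dots> = ennreal (ln N)" using emeasure_space_1 by simp
  finally show ?thesis .
qed

text \<open>The fibre measures come from an unspecified choice, so uniformity must be shown for
  whichever disintegration was chosen. The mass it gives to \<open>U i\<close> is, as a function of
  \<open>x\<close>, a density determined by integrals over Borel sets \<open>C\<close>; scaling
  shows that \<open>1 / c\<close> times the indicator of the image of \<open>U i\<close> has the
  same integrals.\<close>

lemma jacobian_constant_folding_entropy: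
  fixes f :: "'a::metric_space \<Rightarrow> 'a"
  assumes cpt: "compact (UNIV :: 'a set)" and lh: "local_homeo f"
    and prob: "prob_space M" and sM: "sets M = sets borel"
    and card: "\<And>x. card (f -` {x}) = N" and c: "c > 0"
    and scale: "\<And>p. \<exists>V. open V \<and> p \<in> V \<and> inj_on f V \<and> (\<forall>B\<in>sets borel. B \<subseteq> V \<longrightarrow>
       f ` B \<in> sets borel \<longrightarrow> emeasure M (f ` B) = ennreal c * emeasure M B)"
  shows "real N = c" "invariant_prob f M" "folding_entropy f M = ennreal (ln c)"
proof -
  interpret prob_space M by (rule prob)
  note [measurable_cong, simp] = sM
  have spM [simp]: "space M = UNIV" using sets_eq_imp_space_eq[OF sM] by simp
  have fb: "f \<in> borel \<rightarrow>\<^sub>M borel"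
    by (intro borel_measurable_continuous_onI local_homeo_continuous[OF lh])
  then have fM [measurable]: "f \<in> M \<rightarrow>\<^sub>M M" by (simp add: measurable_cong_sets[OF sM sM])
  have fpre: "f -` C \<in> sets M" if "C \<in> sets M" for C
    using measurable_sets[OF fM that] by simp
  let ?Q = "\<lambda>V. inj_on f V \<and> (\<forall>B\<in>sets borel. B \<subseteq> V \<longrightarrow>
       f ` B \<in> sets borel \<longrightarrow> emeasure M (f ` B) = ennreal c * emeasure M B)"
  obtain K U :: "nat \<Rightarrow> 'a set" and m where K: "\<And>i. i < m \<Longrightarrow> compact (K i)"
    and KV: "\<And>i. i < m \<Longrightarrow> \<exists>V. K i \<subseteq> V \<and> ?Q V"
    and UK: "\<And>i. i < m \<Longrightarrow> U i \<subseteq> K i" and Ub0: "\<And>i. i < m \<Longrightarrow> U i \<in> sets borel"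
    and Udisj: "disjoint_family_on U {..<m}" and Uun: "(\<Union>i<m. U i) = UNIV"
    by (rule finite_borel_partition[of ?Q, OF cpt scale]) (rule that)
  have Ub [measurable]: "U i \<in> sets M" if "i < m" for i using Ub0[OF that] by simp
  have split: "emeasure M B = (\<Sum>i<m. emeasure M (U i \<inter> B))" if "B \<in> sets M" for B
    by (rule emeasure_sum_partition) (use that Ub Udisj Uun in auto)
  have Kinj: "inj_on f (K i)" if "i < m" for i using KV[OF that] by (meson inj_on_subset)
  have img: "f ` B \<in> sets M" "emeasure M (f ` B) = ennreal c * emeasure M B"
    if i: "i < m" and "B \<in> sets M" "B \<subseteq> K i" for i B
  proof -
    show *: "f ` B \<in> sets M"
      using borel_image_compact_inj[OF K local_homeo_continuous[OF lh] Kinj, of i B] that by simp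
    obtain V where "K i \<subseteq> V" "?Q V" using KV[OF i] by blast
    then show "emeasure M (f ` B) = ennreal c * emeasure M B"
      using that * by (metis order_trans sM)
  qed
  have fin: "finite (f -` {x})" for x by (rule finite_fiber_local_homeo[OF cpt lh])
  \<comment> \<open>Every piece contains at most one preimage of \<open>x\<close>, so counting the
    images that contain \<open>x\<close> counts the fibre.\<close>
  have count: "(\<Sum>i<m. indicator (f ` U i) x) = ennreal N" for x
  proof -
    have "card (f -` {x}) = card (\<Union>i<m. U i \<inter> f -` {x})"
      using Uun by (intro arg_cong[where f = card]) blast
    also have "\<dots> = (\<Sum>i<m. card (U i \<inter> f -` {x}))"
      using Udisj fin[of x] by (intro card_UN_disjoint) (auto simp: disjoint_family_on_def)
    finally have "real N = (\<Sum>i<m. real (card (U i \<inter> f -` {x})))" by (simp add: card)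
    moreover have "real (card (U i \<inter> f -` {x})) = indicator (f ` U i) x" if "i < m" for i
    proof (cases "x \<in> f ` U i")
      case True
      then obtain y where y: "y \<in> U i" "f y = x" by blast
      have "U i \<inter> f -` {x} = {y}"
        using y UK[OF that] Kinj[OF that] by (auto dest: inj_onD)
      then show ?thesis using True by simp
    next
      case False
      then have "U i \<inter> f -` {x} = {}" by blast
      then show ?thesis using False by simp
    qed
    ultimately have "real N = (\<Sum>i<m. indicator (f ` U i) x)" by simp
    then show ?thesis by (simp add: ennreal_indicator sum_ennreal[symmetric])
  qed
  have piece: "ennreal c * emeasure M (U i \<inter> f -` C) = emeasure M (f ` U i \<inter> C)"
    if "i < m" "C \<in> sets M" for i C
  proof -
    have "f ` (U i \<inter> f -` C) = f ` U i \<inter> C" by blast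
    moreover have "U i \<inter> f -` C \<subseteq> K i" using UK[OF that(1)] by blast
    moreover have "U i \<inter> f -` C \<in> sets M" using that fpre Ub by blast
    ultimately show ?thesis using img(2)[OF that(1)] by metis
  qed
  have fU: "f ` U i \<in> sets M" if "i < m" for i by (rule img(1)[OF that Ub[OF that] UK[OF that]])
  have pre: "ennreal c * emeasure M (f -` C) = ennreal N * emeasure M C" if C: "C \<in> sets M" for C
  proof -
    have "ennreal c * emeasure M (f -` C) = (\<Sum>i<m. emeasure M (f ` U i \<inter> C))"
      using split[OF fpre[OF C]] piece C by (simp add: sum_distrib_left)
    also have "\<dots> = (\<Sum>i<m. \<integral>\<^sup>+x. indicator (f ` U i) x * indicator C x \<partial>M)"
      using fU C by (intro sum.cong) (auto simp: indicator_inter_arith[symmetric])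
    also have "\<dots> = (\<integral>\<^sup>+x. (\<Sum>i<m. indicator (f ` U i) x * indicator C x) \<partial>M)"
      using fU C by (intro nn_integral_sum[symmetric]) auto
    also have "\<dots> = (\<integral>\<^sup>+x. ennreal N * indicator C x \<partial>M)"
      by (simp add: sum_distrib_right[symmetric] count)
    also have "\<dots> = ennreal N * emeasure M C" using C by (simp add: nn_integral_cmult)
    finally show ?thesis .
  qed
  \<comment> \<open>For the whole space, both measures in \<open>pre\<close> are 1.\<close>
  have "ennreal c = ennreal N" using pre[of UNIV] emeasure_space_1 by simp
  then show N: "real N = c" using c by simp
  have pre': "emeasure M (f -` C) = emeasure M C" if "C \<in> sets M" for C
    using pre[OF that] c unfolding N by (simp add: ennreal_mult_cancel_left)
  show inv: "invariant_prob f M"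
    unfolding invariant_prob_def
  proof (intro conjI prob sM fM measure_eqI)
    show "emeasure (distr M M f) C = emeasure M C" if "C \<in> sets (distr M M f)" for C
      using that pre'[of C] by (subst emeasure_distr) auto
  qed simp
  let ?\<kappa> = "fiber_measure f M"
  have dis: "fiber_disintegration f M ?\<kappa>"
    unfolding fiber_measure_def using fiber_disintegration_exists[OF cpt lh inv] by (rule someI_ex)
  have \<kappa>m: "?\<kappa> \<in> M \<rightarrow>\<^sub>M prob_algebra M"
    and \<kappa>f: "AE x in M. emeasure (?\<kappa> x) (f -` {x}) = 1"
    and \<kappa>i: "\<And>B. B \<in> sets M \<Longrightarrow> emeasure M B = (\<integral>\<^sup>+ x. emeasure (?\<kappa> x) B \<partial>M)"
    using dis by (auto simp: fiber_disintegration_def)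
  have \<kappa>p: "prob_space (?\<kappa> x)" and \<kappa>s: "sets (?\<kappa> x) = sets borel" for x
    using measurable_space[OF \<kappa>m, of x] by (auto simp: space_prob_algebra)
  have \<kappa>AE: "AE y in ?\<kappa> x. f y = x" if "emeasure (?\<kappa> x) (f -` {x}) = 1" for x
  proof -
    interpret \<kappa>: prob_space "?\<kappa> x" by (rule \<kappa>p)
    have "\<kappa>.prob (f -` {x}) = 1" using that by (simp add: measure_def)
    then show ?thesis using \<kappa>.AE_prob_1 by fastforce
  qed
  have \<kappa>U: "AE x in M. emeasure (?\<kappa> x) (U i) = ennreal (1 / c) * indicator (f ` U i) x"
    if i: "i < m" for i
  proof (rule density_unique2)
    show "(\<lambda>x. emeasure (?\<kappa> x) (U i)) \<in> borel_measurable M"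
      by (rule measurable_emeasure_kernel[OF measurable_prob_algebraD[OF \<kappa>m] Ub[OF i]])
    show "(\<lambda>x. ennreal (1 / c) * indicator (f ` U i) x) \<in> borel_measurable M"
      using fU[OF i] by measurable
    fix C assume C: "C \<in> sets M"
    \<comment> \<open>The measure over \<open>x\<close> lives on points mapped to \<open>x\<close>,
      so intersecting with the preimage of \<open>C\<close> changes nothing if \<open>x\<close> is
      in \<open>C\<close> and leaves a null set otherwise.\<close>
    have "AE x in M. emeasure (?\<kappa> x) (U i) * indicator C x = emeasure (?\<kappa> x) (U i \<inter> f -` C)"
      using \<kappa>f
    proof eventually_elim
      case (elim x)
      note ae = \<kappa>AE[OF elim]
      have s: "U i \<in> sets (?\<kappa> x)" "U i \<inter> f -` C \<in> sets (?\<kappa> x)"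
        using Ub[OF i] fpre[OF C] by (auto simp: \<kappa>s)
      show ?case
      proof (cases "x \<in> C")
        case True
        then have "emeasure (?\<kappa> x) (U i) = emeasure (?\<kappa> x) (U i \<inter> f -` C)"
          using ae s by (intro emeasure_eq_AE) (auto elim: eventually_mono)
        then show ?thesis using True by simp
      next
        case False
        then have "emeasure (?\<kappa> x) {} = emeasure (?\<kappa> x) (U i \<inter> f -` C)"
          using ae s by (intro emeasure_eq_AE) (auto elim: eventually_mono)
        then show ?thesis using False by simp
      qed
    qed
    then have "(\<integral>\<^sup>+x. emeasure (?\<kappa> x) (U i) * indicator C x \<partial>M)
        = (\<integral>\<^sup>+x. emeasure (?\<kappa> x) (U i \<inter> f -` C) \<partial>M)" by (rule nn_integral_cong_AE)
    also have "\<dots> = emeasure M (U i \<inter> f -` C)"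
      by (rule \<kappa>i[symmetric]) (use Ub[OF i] fpre[OF C] in auto)
    also have "\<dots> = ennreal (1 / c) * (ennreal c * emeasure M (U i \<inter> f -` C))"
      using c by (simp add: mult.assoc[symmetric] ennreal_mult[symmetric])
    also have "\<dots> = ennreal (1 / c) * emeasure M (f ` U i \<inter> C)" by (simp only: piece[OF i C])
    also have "\<dots> = (\<integral>\<^sup>+x. ennreal (1 / c) * indicator (f ` U i \<inter> C) x \<partial>M)"
      using fU[OF i] C by (subst nn_integral_cmult) auto
    also have "\<dots> = (\<integral>\<^sup>+x. ennreal (1 / c) * indicator (f ` U i) x * indicator C x \<partial>M)"
      by (simp add: indicator_inter_arith mult.assoc)
    finally show "(\<integral>\<^sup>+x\<in>C. emeasure (?\<kappa> x) (U i) \<partial>M)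
        = (\<integral>\<^sup>+x\<in>C. ennreal (1 / c) * indicator (f ` U i) x \<partial>M)" .
  qed
  have "AE x in M. \<forall>i\<in>{..<m}. emeasure (?\<kappa> x) (U i) = ennreal (1 / c) * indicator (f ` U i) x"
    using \<kappa>U by (intro AE_finite_allI) auto
  then have "AE x in M. fiber_entropy f M x = ennreal (ln c)"
    using \<kappa>f
  proof eventually_elim
    case (elim x)
    have point: "measure (?\<kappa> x) {y} = 1 / c" if y: "y \<in> f -` {x}" for y
    proof -
      obtain i where i: "i < m" "y \<in> U i" using Uun by blast
      have "{y} \<in> sets (?\<kappa> x)" "U i \<in> sets (?\<kappa> x)" using Ub[OF i(1)] by (auto simp: \<kappa>s)
      \<comment> \<open>Within the fibre, \<open>U i\<close> contains no point besides
        \<open>y\<close>; knowing the masses of the finitely many pieces is thus enough to know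
        every atom.\<close>
      moreover have "AE z in ?\<kappa> x. z \<in> {y} \<longleftrightarrow> z \<in> U i"
        using \<kappa>AE[OF elim(2)]
      proof eventually_elim
        case (elim z)
        then show ?case using i y UK[OF i(1)] Kinj[OF i(1)] by (auto dest: inj_onD)
      qed
      ultimately have "emeasure (?\<kappa> x) {y} = emeasure (?\<kappa> x) (U i)" by (intro emeasure_eq_AE)
      also have "\<dots> = ennreal (1 / c)" using elim(1) i y by auto
      finally show ?thesis using c by (simp add: measure_def)
    qed
    have "fiber_entropy f M x = ennreal (\<Sum>y\<in>f -` {x}. - (1 / c * ln (1 / c)))"
      using fiber_entropy_finite[of f x M] fin[of x] \<kappa>p[of x] point by simp
    also have "(\<Sum>y\<in>f -` {x}. - (1 / c * ln (1 / c))) = ln c"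
      using c N card[of x] by (simp add: ln_div)
    finally show ?case .
  qed
  then have "folding_entropy f M = (\<integral>\<^sup>+x. ennreal (ln c) \<partial>M)"
    unfolding folding_entropy_def by (rule nn_integral_cong_AE)
  also have "\<dots> = ennreal (ln c)" using emeasure_space_1 by simp
  finally show "folding_entropy f M = ennreal (ln c)" .
qed

section \<open>Entropy production on the torus\<close>

text \<open>Continuity of the lift's derivative is what the inverse function theorem asks for. The
  Haar case supplies \<open>c = N\<close>, by which the bound \<open>ln N\<close> for an arbitrary
  invariant measure equals the Jacobian integral \<open>ln c\<close>.\<close>

lemma torus_entropy_production:
  fixes f :: "'n::finite torus \<Rightarrow> 'n torus"
  assumes lift: "\<And>x. \<exists>F (F' :: real ^ 'n \<Rightarrow> (real ^ 'n) \<Rightarrow>\<^sub>L (real ^ 'n)) U. open U \<and> x \<in> U \<and>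
      lifts_on U F f \<and> (\<forall>v\<in>U. (F has_derivative blinfun_apply (F' v)) (at v)) \<and> continuous_on U F'"
    and det: "\<And>p. \<bar>det (torus_deriv f p)\<bar> = c" and c: "c > 0"
  shows "invariant_prob f \<mu> \<Longrightarrow> entropy_production f \<mu> \<le> 0"
    and "entropy_production f torus_lebesgue = 0"
proof -
  have local: "\<exists>V. open V \<and> p \<in> V \<and> inj_on f V \<and> continuous_on V f \<and>
      (\<forall>W. open W \<longrightarrow> W \<subseteq> V \<longrightarrow> open (f ` W)) \<and>
      (\<forall>B\<in>sets borel. B \<subseteq> V \<longrightarrow> f ` B \<in> sets borel \<longrightarrow>
        emeasure torus_lebesgue (f ` B) = ennreal c * emeasure torus_lebesgue B)" for p
  proof -
    obtain x where x: "p = torus_proj x" using surj_torus_proj by (metis surjD)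
    obtain F and F' :: "real ^ 'n \<Rightarrow> (real ^ 'n) \<Rightarrow>\<^sub>L (real ^ 'n)" and U
      where U: "open U" "x \<in> U" "lifts_on U F f"
        "\<And>v. v \<in> U \<Longrightarrow> (F has_derivative blinfun_apply (F' v)) (at v)" "continuous_on U F'"
      using lift[of x] by blast
    obtain V where "open V" "torus_proj x \<in> V" "inj_on f V" "continuous_on V f"
      "\<And>W. open W \<Longrightarrow> W \<subseteq> V \<Longrightarrow> open (f ` W)"
      "\<And>B. B \<in> sets borel \<Longrightarrow> B \<subseteq> V \<Longrightarrow> f ` B \<in> sets borel \<Longrightarrow>
         emeasure torus_lebesgue (f ` B) = ennreal c * emeasure torus_lebesgue B"
      using torus_local_lift[OF U det c] by metis
    then show ?thesis using x by (intro exI[of _ V]) simp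
  qed
  have lh: "local_homeo f"
    unfolding local_homeo_def using local by meson
  define N where "N = card (f -` {torus_proj 0})"
  have card: "card (f -` {x}) = N" for x
    unfolding N_def by (rule card_fiber_constant[OF compact_torus lh connected_torus])
  have scale: "\<exists>V. open V \<and> p \<in> V \<and> inj_on f V \<and> (\<forall>B\<in>sets borel. B \<subseteq> V \<longrightarrow>
       f ` B \<in> sets borel \<longrightarrow> emeasure torus_lebesgue (f ` B) = ennreal c * emeasure torus_lebesgue B)" for p
    using local[of p] by meson
  note haar = jacobian_constant_folding_entropy[OF compact_torus lh prob_space_torus_lebesgue
      sets_torus_lebesgue card c scale]
  have N: "N > 0" using haar(1) c by simp
  \<comment> \<open>As a positive fibre cardinality, \<open>c\<close> is at least 1; hence
    \<open>ennreal (ln c)\<close> does not truncate \<open>ln c\<close> to 0.\<close>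
  have ln: "0 \<le> ln c" using haar(1) N by (metis ln_ge_zero One_nat_def Suc_leI of_nat_1 of_nat_le_iff)
  have prod: "entropy_production f M = enn2ereal (folding_entropy f M) - ereal (ln c)"
    if "prob_space M" for M
  proof -
    interpret prob_space M by (rule that)
    show ?thesis unfolding entropy_production_def by (simp add: det prob_space)
  qed
  show "entropy_production f torus_lebesgue = 0"
    unfolding prod[OF prob_space_torus_lebesgue] haar(3) using ln by simp
  assume inv: "invariant_prob f \<mu>"
  have "folding_entropy f \<mu> \<le> ennreal (ln c)"
    using folding_entropy_le[OF compact_torus lh inv card N] haar(1) by simp
  then have "enn2ereal (folding_entropy f \<mu>) \<le> ereal (ln c)"
    using ln by (metis enn2ereal_ennreal less_eq_ennreal.rep_eq)
  moreover have "prob_space \<mu>" using inv by (simp add: invariant_prob_def)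
  ultimately show "entropy_production f \<mu> \<le> 0" by (simp add: prod ereal_minus_le_iff)
qed

section \<open>Linear and Anosov maps satisfy the local hypotheses\<close>

lemma det_map_matrix_of_int:
  "det (map_matrix of_int A :: 'a::comm_ring_1 ^ 'n::finite ^ 'n) = of_int (det A)"
  by (simp add: det_def)

text \<open>Without eigenvalue 0 the complexified matrix has trivial kernel and is invertible, and
  its determinant is the integer determinant.\<close>

lemma det_nonzero_if_no_zero_eigenvalue:
  assumes "\<not> eigenvalue_of A 0"
  shows "det A \<noteq> 0"
proof -
  have "\<forall>v :: complex ^ 'a. map_matrix of_int A *v v = 0 \<longrightarrow> v = 0"
    using assms by (auto simp: eigenvalue_of_def)
  then have "invertible (map_matrix of_int A :: complex ^ 'a ^ 'a)"
    by (metis invertible_left_inverse matrix_left_invertible_ker)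
  then show ?thesis by (auto simp: invertible_det_nz det_map_matrix_of_int)
qed

lemma toral_endo_lift: "lifts_on U ((*v) (map_matrix of_int A)) (toral_endo A)"
  by (simp add: lifts_on_def toral_endo.abs_eq)

lemma torus_deriv_toral_endo: "torus_deriv (toral_endo A) p = map_matrix of_int A"
proof (rule torus_deriv_eq)
  obtain x where x: "torus_proj x = p" using surj_torus_proj by (metis surjD)
  have "((*v) (map_matrix of_int A) has_derivative (*v) (map_matrix of_int A)) (at x)"
    by (rule bounded_linear_imp_has_derivative) simp
  then show "has_torus_derivative (toral_endo A) (map_matrix of_int A) p"
    unfolding has_torus_derivative_def using x toral_endo_lift by blast
qed

text \<open>A differentiable first derivative is continuous.\<close>

lemma C2_on_imp_C1:
  assumes "C2_on U F"
  obtains F' where "\<And>v. v \<in> U \<Longrightarrow> (F has_derivative blinfun_apply (F' v)) (at v)" "continuous_on U F'"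
proof -
  obtain F' F'' where F: "\<forall>x\<in>U. (F has_derivative blinfun_apply (F' x)) (at x)"
    "\<forall>x\<in>U. (F' has_derivative blinfun_apply (F'' x)) (at x)"
    using assms unfolding C2_on_def by blast
  show thesis
    by (rule that[of F']) (use F in \<open>auto intro!: continuous_at_imp_continuous_on has_derivative_continuous\<close>)
qed

text \<open>Equilibrium measures are invariant by definition, so both cases are instances of
  \<open>torus_entropy_production\<close>: with the linear map itself as a global lift of constant
  derivative, and with the C2 local lifts.\<close>

theorem corollary1:
  assumes "CARD('n::finite) \<ge> 2"
  shows "(\<forall>A :: int ^ 'n ^ 'n.
            hyperbolic_matrix A \<and> \<not> eigenvalue_of A 0 \<and> \<not> bij (toral_endo A) \<longrightarrow>
            (\<forall>\<phi> \<mu>. hoelder_continuous \<phi> \<and> equilibrium_measure (toral_endo A) \<phi> \<mu> \<longrightarrow>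
               entropy_production (toral_endo A) \<mu> \<le> 0) \<and>
            entropy_production (toral_endo A) torus_lebesgue = 0)
       \<and> (\<forall>f :: 'n torus \<Rightarrow> 'n torus.
            torus_C2 f \<and> anosov_endomorphism f \<and> topologically_transitive f \<and> \<not> bij f \<and>
            (\<forall>x. det (torus_deriv f x) \<noteq> 0) \<and> (\<exists>c. \<forall>x. det (torus_deriv f x) = c) \<longrightarrow>
            (\<forall>\<phi> \<mu>. hoelder_continuous \<phi> \<and> equilibrium_measure f \<phi> \<mu> \<longrightarrow>
               entropy_production f \<mu> \<le> 0) \<and>
            entropy_production f torus_lebesgue = 0)"
proof (intro conjI allI impI)
  fix A :: "int ^ 'n ^ 'n"
  assume "hyperbolic_matrix A \<and> \<not> eigenvalue_of A 0 \<and> \<not> bij (toral_endo A)"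
  then have "det A \<noteq> 0" by (intro det_nonzero_if_no_zero_eigenvalue) simp
  then have c: "0 < \<bar>real_of_int (det A)\<bar>" by simp
  have det: "\<bar>det (torus_deriv (toral_endo A) p)\<bar> = \<bar>real_of_int (det A)\<bar>" for p
    by (simp add: torus_deriv_toral_endo det_map_matrix_of_int)
  define F where "F = ((*v) (map_matrix of_int A) :: real ^ 'n \<Rightarrow> real ^ 'n)"
  have "bounded_linear F" by (simp add: F_def)
  then have "(F has_derivative blinfun_apply (Blinfun F)) (at v)" for v
    by (simp add: bounded_linear_Blinfun_apply bounded_linear_imp_has_derivative)
  then have lift: "\<exists>F (F' :: real ^ 'n \<Rightarrow> (real ^ 'n) \<Rightarrow>\<^sub>L (real ^ 'n)) U. open U \<and> x \<in> U \<and>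
      lifts_on U F (toral_endo A) \<and> (\<forall>v\<in>U. (F has_derivative blinfun_apply (F' v)) (at v)) \<and>
      continuous_on U F'" for x
    by (intro exI[of _ F] exI[of _ "\<lambda>_. Blinfun F"] exI[of _ UNIV])
      (simp add: F_def toral_endo_lift)
  note main = torus_entropy_production[OF lift det c]
  show "entropy_production (toral_endo A) torus_lebesgue = 0" by (rule main(2))
  show "entropy_production (toral_endo A) \<mu> \<le> 0"
    if "hoelder_continuous \<phi> \<and> equilibrium_measure (toral_endo A) \<phi> \<mu>" for \<phi> \<mu>
    by (rule main(1)) (use that in \<open>simp add: equilibrium_measure_def\<close>)
next
  fix f :: "'n torus \<Rightarrow> 'n torus"
  assume f: "torus_C2 f \<and> anosov_endomorphism f \<and> topologically_transitive f \<and> \<not> bij f \<and>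
    (\<forall>x. det (torus_deriv f x) \<noteq> 0) \<and> (\<exists>c. \<forall>x. det (torus_deriv f x) = c)"
  then obtain d where d: "\<And>x. det (torus_deriv f x) = d" by blast
  \<comment> \<open>The sign of the determinant is arbitrary; its modulus is the factor by which
    volume is multiplied.\<close>
  have c: "0 < \<bar>d\<bar>" using f d by auto
  have det: "\<bar>det (torus_deriv f p)\<bar> = \<bar>d\<bar>" for p using d by simp
  have lift: "\<exists>F (F' :: real ^ 'n \<Rightarrow> (real ^ 'n) \<Rightarrow>\<^sub>L (real ^ 'n)) U. open U \<and> x \<in> U \<and>
      lifts_on U F f \<and> (\<forall>v\<in>U. (F has_derivative blinfun_apply (F' v)) (at v)) \<and>
      continuous_on U F'" for x
  proof -
    obtain F U where U: "open U" "x \<in> U" "lifts_on U F f" "C2_on U F"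
      using f unfolding torus_C2_def by blast
    obtain F' where "\<And>v. v \<in> U \<Longrightarrow> (F has_derivative blinfun_apply (F' v)) (at v)" "continuous_on U F'"
      using C2_on_imp_C1[OF U(4)] by blast
    then show ?thesis using U by blast
  qed
  note main = torus_entropy_production[OF lift det c]
  show "entropy_production f torus_lebesgue = 0" by (rule main(2))
  show "entropy_production f \<mu> \<le> 0" if "hoelder_continuous \<phi> \<and> equilibrium_measure f \<phi> \<mu>" for \<phi> \<mu>
    by (rule main(1)) (use that in \<open>simp add: equilibrium_measure_def\<close>)
qed

end
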